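(* Let $N\ge3$ and let $$V_1(x)=\sum_{i=1}^{k_1}\frac{\lambda_i^1\chi_{B(a_i^1,r_i^1)}(x)}{|x-a_i^1|^2}+\frac{\lambda_\infty^1\chi_{\mathbb{R}^N\setminus B(0,R_1)}(x)}{|x|^2}+W_1(x),\qquad V_2(x)=\sum_{i=1}^{k_2}\frac{\lambda_i^2\chi_{B(a_i^2,r_i^2)}(x)}{|x-a_i^2|^2}+\frac{\lambda_\infty^2\chi_{\mathbb{R}^N\setminus B(0,R_2)}(x)}{|x|^2}+W_2(x)$$ be two potentials in the class $\mathcal{V}$. Assume $\mu(V_1)>0$, $\mu(V_2)>0$ and $\lambda_\infty^1+\lambda_\infty^2<\left(\frac{N-2}{2}\right)^2$. Then there exists $R>0$ such that for every $y\in\mathbb{R}^N$ with $|y|\ge R$ the quadratic form $u\mapsto\int_{\mathbb{R}^N}|\nabla u|^2dx-\int_{\mathbb{R}^N}(V_1(x)+V_2(x-y))u^2(x)\,dx$ associated with $-\Delta-(V_1+V_2(\cdot-y))$ is positive definite on $\mathcal{D}^{1,2}(\mathbb{R}^N)$ (i.e. bounded below by $\varepsilon\int|\nabla u|^2$ for some $\varepsilon>0$).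
   Context: $N\ge3$. $\mathcal{D}^{1,2}(\mathbb{R}^N)$ is the completion of $C_c^\infty(\mathbb{R}^N)$ for the norm $(\int|\nabla u|^2)^{1/2}$. The class $\mathcal{V}$ consists of all functions $V(x)=\sum_{i=1}^k\frac{\lambda_i\chi_{B(a_i,r_i)}(x)}{|x-a_i|^2}+\frac{\lambda_\infty\chi_{\mathbb{R}^N\setminus B(0,R)}(x)}{|x|^2}+W(x)$ with $k\in\mathbb{N}$, $r_i,R>0$, $a_i\in\mathbb{R}^N$ pairwise distinct, $\lambda_i,\lambda_\infty\in(-\infty,\frac{(N-2)^2}{4})$, and $W\in L^{N/2}(\mathbb{R}^N)\cap L^\infty(\mathbb{R}^N)$; $\chi_A$ is the characteristic function of $A$ and $B(a,r)$ the open ball. For such $V$, $\mu(V)=\inf_{u\in\mathcal{D}^{1,2}(\mathbb{R}^N)\setminus\{0\}}\frac{\int_{\mathbb{R}^N}(|\nabla u|^2-Vu^2)dx}{\int_{\mathbb{R}^N}|\nabla u|^2dx}$. *)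

theory Defs
  imports "HOL-Analysis.Analysis"
begin

coinductive smooth_fun :: "(real^'n \<Rightarrow> real) \<Rightarrow> bool" where
  "(\<forall>x. f differentiable (at x)) \<Longrightarrow>
   (\<forall>i. smooth_fun (\<lambda>x. frechet_derivative f (at x) (axis i 1))) \<Longrightarrow> smooth_fun f"

definition grad :: "(real^'n \<Rightarrow> real) \<Rightarrow> real^'n \<Rightarrow> real^'n" where
  "grad f x = (\<chi> i. frechet_derivative f (at x) (axis i 1))"

definition Cc_inf :: "(real^'n \<Rightarrow> real) set" where
  "Cc_inf = {f. smooth_fun f \<and> compact (closure {x. f x \<noteq> 0})}"

text \<open>Elements of D^{1,2}(R^N), the completion of C_c^infinity for the norm
  (int |grad u|^2)^(1/2), realised concretely: u is (a representative of) an element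
  of the completion, with (weak) gradient G, iff there is a sequence phi_k in C_c^infinity
  whose gradients converge to G in L^2 and which converges to u almost everywhere.\<close>
definition in_D12 :: "(real^'n \<Rightarrow> real) \<Rightarrow> (real^'n \<Rightarrow> real^'n) \<Rightarrow> bool" where
  "in_D12 u G \<longleftrightarrow>
     G \<in> borel_measurable lborel \<and> integrable lborel (\<lambda>x. (norm (G x))\<^sup>2) \<and>
     (\<exists>\<phi>::nat \<Rightarrow> real^'n \<Rightarrow> real. (\<forall>k. \<phi> k \<in> Cc_inf) \<and>
        (\<lambda>k. integral\<^sup>L lborel (\<lambda>x. (norm (grad (\<phi> k) x - G x))\<^sup>2)) \<longlonglongrightarrow> 0 \<and>
        (AE x in lborel. (\<lambda>k. \<phi> k x) \<longlonglongrightarrow> u x))"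

definition Vpot :: "nat \<Rightarrow> (nat \<Rightarrow> real^'n) \<Rightarrow> (nat \<Rightarrow> real) \<Rightarrow> (nat \<Rightarrow> real) \<Rightarrow> real
     \<Rightarrow> real \<Rightarrow> (real^'n \<Rightarrow> real) \<Rightarrow> real^'n \<Rightarrow> real" where
  "Vpot k a r lam laminf R W x =
     (\<Sum>i<k. lam i * indicator (ball (a i) (r i)) x / (norm (x - a i))\<^sup>2)
     + laminf * indicator (UNIV - ball 0 R) x / (norm x)\<^sup>2 + W x"

definition class_V_params :: "nat \<Rightarrow> (nat \<Rightarrow> real^'n) \<Rightarrow> (nat \<Rightarrow> real) \<Rightarrow> (nat \<Rightarrow> real)
     \<Rightarrow> real \<Rightarrow> real \<Rightarrow> (real^'n \<Rightarrow> real) \<Rightarrow> bool" where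
  "class_V_params k a r lam laminf R W \<longleftrightarrow>
     (\<forall>i<k. r i > 0) \<and> R > 0 \<and> inj_on a {..<k} \<and>
     (\<forall>i<k. lam i < (real CARD('n) - 2)\<^sup>2 / 4) \<and> laminf < (real CARD('n) - 2)\<^sup>2 / 4 \<and>
     W \<in> borel_measurable lborel \<and>
     integrable lborel (\<lambda>x. \<bar>W x\<bar> powr (real CARD('n) / 2)) \<and>
     (\<exists>C. AE x in lborel. \<bar>W x\<bar> \<le> C)"

definition mu :: "(real^'n \<Rightarrow> real) \<Rightarrow> real" where
  "mu V = Inf {(integral\<^sup>L lborel (\<lambda>x. (norm (G x))\<^sup>2) - integral\<^sup>L lborel (\<lambda>x. V x * (u x)\<^sup>2))
                 / integral\<^sup>L lborel (\<lambda>x. (norm (G x))\<^sup>2)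
              | u G. in_D12 u G \<and> \<not> (AE x in lborel. u x = 0)}"

end

(* The form of -Delta - V1 - V2(. - y) is localised with smooth partitions of unity
   sin^2 + cos^2 = 1 that vary on a logarithmic scale: f is split around the origin into
   f1 + g, then g around y into f2 + f3. The gradients of the angles are at most
   sqrt s / |x| and sqrt s / |x - y|, so by Hardy's inequality the splitting changes the
   Dirichlet integral by a factor arbitrarily close to 1.
   On f1 the form of V1 is controlled by mu V1 > 0 and V2(. - y) is negligible, on f2 the roles
   are exchanged, and on f3 only laminf1 / |x|^2 + laminf2 / |x - y|^2 survives, which the
   sharp Hardy inequality dominates because both coefficients and their sum are less than
   ((N - 2) / 2)^2. "Negligible" is meant as a form bound: pole terms are handled by Hardy's
   inequality and the L^(N/2) terms by Sobolev's. The estimate for test functions passes to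
   D^{1,2} because form-bounded potentials give continuous quadratic forms. *)
theory Submission
  imports Defs
begin

section \<open>Smooth functions and test functions\<close>

text \<open>The obstacle is scale invariance. An ordinary cutoff between radii r and 2r has gradient
  of order 1/r, so its error is a fixed multiple of the Hardy term for every r and cannot be
  absorbed. A gradient of at most a small multiple of 1/|x| is needed, which forces a very slow
  transition. A small negative power of 1 + c |x|^2 provides such an angle by one formula that is
  smooth on the whole space; the price is that neither its sine nor its cosine vanishes on an open
  set. The pieces therefore have no separated supports: a potential is never removed near its poles,
  only multiplied by a small factor there. This is harmless because smallness is measured by form
  bounds, and a small factor makes any form-bounded potential small in that sense. The order of the
  choices matters. The angle depends only on V1, V2 and the tolerance, and the second cutoff is its
  translate by y. Hence |y| can be taken large at the very end, and the resulting lower bound is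
  uniform in y.\<close>

lemma frechet_derivative_GDERIV:
  assumes "GDERIV f x :> D"
  shows "frechet_derivative f (at x) = (\<lambda>h. h \<bullet> D)"
  using frechet_derivative_at[OF assms[unfolded gderiv_def]] by simp

lemma grad_eqI: "GDERIV f x :> D \<Longrightarrow> grad f x = D"
  by (simp add: grad_def frechet_derivative_GDERIV vec_eq_iff inner_axis')

lemma GDERIV_grad:
  assumes "f differentiable (at x)"
  shows "GDERIV f x :> grad f x"
proof -
  let ?D = "frechet_derivative f (at x)"
  have D: "(f has_derivative ?D) (at x)" using assms frechet_derivative_works by blast
  then have lin: "linear ?D" by (rule has_derivative_linear)
  have "?D h = h \<bullet> grad f x" for h
  proof -
    have "?D h = ?D (\<Sum>i\<in>UNIV. h $ i *\<^sub>R axis i 1)"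
      by (simp add: basis_expansion[of h, unfolded scalar_mult_eq_scaleR])
    also have "\<dots> = (\<Sum>i\<in>UNIV. h $ i * ?D (axis i 1))"
      using lin by (simp add: linear_sum linear_cmul)
    finally show ?thesis by (simp add: inner_vec_def grad_def)
  qed
  then have "?D = (\<lambda>h. h \<bullet> grad f x)" by blast
  then show ?thesis using D by (simp add: gderiv_def)
qed

lemma GDERIV_differentiable: "GDERIV f x :> D \<Longrightarrow> f differentiable (at x)"
  by (auto simp: gderiv_def differentiable_def)

lemma GDERIV_shift: "GDERIV f (x + a) :> D \<Longrightarrow> GDERIV (\<lambda>x. f (x + a)) x :> D"
  unfolding gderiv_def
  by (rule has_derivative_compose[of "\<lambda>x. x + a" "\<lambda>h. h" x UNIV f])
    (auto intro!: derivative_eq_intros)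

lemma GDERIV_component: "GDERIV (\<lambda>x. x $ i) x :> axis i 1"
  unfolding gderiv_def
  by (auto intro!: derivative_eq_intros bounded_linear.has_derivative[OF bounded_linear_vec_nth] simp: inner_axis)

text \<open>Since \<open>smooth_fun\<close> is coinductive, its closure properties are obtained all at once: the
  inductive closure below is stable under partial derivatives, hence contained in \<open>smooth_fun\<close>.\<close>

inductive smooth_gen :: "(real^'n \<Rightarrow> real) \<Rightarrow> bool" where
  base: "smooth_fun f \<Longrightarrow> smooth_gen f"
| const: "smooth_gen (\<lambda>x. c)"
| comp: "smooth_gen (\<lambda>x. x $ i)"
| add: "smooth_gen f \<Longrightarrow> smooth_gen g \<Longrightarrow> smooth_gen (\<lambda>x. f x + g x)"
| mult: "smooth_gen f \<Longrightarrow> smooth_gen g \<Longrightarrow> smooth_gen (\<lambda>x. f x * g x)"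
| shift: "smooth_gen f \<Longrightarrow> smooth_gen (\<lambda>x. f (x + a))"
| powr: "smooth_gen f \<Longrightarrow> (\<And>x. f x > 0) \<Longrightarrow> smooth_gen (\<lambda>x. f x powr p)"
| sin: "smooth_gen f \<Longrightarrow> smooth_gen (\<lambda>x. sin (f x))"
| cos: "smooth_gen f \<Longrightarrow> smooth_gen (\<lambda>x. cos (f x))"

lemma smooth_fun_differentiable: "smooth_fun f \<Longrightarrow> f differentiable (at x)"
  by (auto elim: smooth_fun.cases)

lemma smooth_fun_grad: "smooth_fun f \<Longrightarrow> smooth_fun (\<lambda>x. grad f x $ i)"
  by (auto elim: smooth_fun.cases simp: grad_def)

text \<open>The derivative is left existential: each constructor supplies the one given by its own
  differentiation rule, and its components are again built from the constructors.\<close>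

lemma smooth_gen_grad:
  assumes "smooth_gen f"
  shows "\<exists>D. (\<forall>x. GDERIV f x :> D x) \<and> (\<forall>i. smooth_gen (\<lambda>x. D x $ i))"
  using assms
proof induction
  case (base f)
  then show ?case
    by (intro exI[of _ "grad f"])
      (auto intro: GDERIV_grad smooth_fun_differentiable smooth_gen.base smooth_fun_grad)
next
  case (const c)
  show ?case by (intro exI[of _ "\<lambda>x. 0"]) (auto intro: GDERIV_const smooth_gen.const)
next
  case (comp i)
  show ?case by (intro exI[of _ "\<lambda>x. axis i 1"]) (auto intro: GDERIV_component smooth_gen.const)
next
  case (add f g)
  then obtain D E where "\<forall>x. GDERIV f x :> D x" "\<forall>i. smooth_gen (\<lambda>x. D x $ i)"
      "\<forall>x. GDERIV g x :> E x" "\<forall>i. smooth_gen (\<lambda>x. E x $ i)" by blast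
  then show ?case
    by (intro exI[of _ "\<lambda>x. D x + E x"]) (auto intro!: GDERIV_add smooth_gen.add)
next
  case (mult f g)
  then obtain D E where "\<forall>x. GDERIV f x :> D x" "\<forall>i. smooth_gen (\<lambda>x. D x $ i)"
      "\<forall>x. GDERIV g x :> E x" "\<forall>i. smooth_gen (\<lambda>x. E x $ i)" by blast
  then show ?case using mult.hyps
    by (intro exI[of _ "\<lambda>x. f x *\<^sub>R E x + g x *\<^sub>R D x"])
      (auto intro!: GDERIV_mult smooth_gen.add smooth_gen.mult)
next
  case (shift f a)
  then obtain D where "\<forall>x. GDERIV f x :> D x" "\<forall>i. smooth_gen (\<lambda>x. D x $ i)" by blast
  then show ?case
    by (intro exI[of _ "\<lambda>x. D (x + a)"]) (auto intro!: GDERIV_shift smooth_gen.shift)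
next
  case (powr f p)
  then obtain D where D: "\<And>x. GDERIV f x :> D x" "\<forall>i. smooth_gen (\<lambda>x. D x $ i)" by blast
  have "GDERIV (\<lambda>x. f x powr p) x :> (p * f x powr (p - 1)) *\<^sub>R D x" for x
    using powr.hyps by (intro GDERIV_DERIV_compose D has_real_derivative_powr) auto
  then show ?case using powr.hyps D
    by (intro exI[of _ "\<lambda>x. (p * f x powr (p - 1)) *\<^sub>R D x"])
      (auto intro!: smooth_gen.mult smooth_gen.const smooth_gen.powr)
next
  case (sin f)
  then obtain D where D: "\<And>x. GDERIV f x :> D x" "\<forall>i. smooth_gen (\<lambda>x. D x $ i)" by blast
  have "GDERIV (\<lambda>x. sin (f x)) x :> cos (f x) *\<^sub>R D x" for x
    by (intro GDERIV_DERIV_compose D DERIV_sin)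
  then show ?case using sin.hyps D
    by (intro exI[of _ "\<lambda>x. cos (f x) *\<^sub>R D x"]) (auto intro!: smooth_gen.mult smooth_gen.cos)
next
  case (cos f)
  then obtain D where D: "\<And>x. GDERIV f x :> D x" "\<forall>i. smooth_gen (\<lambda>x. D x $ i)" by blast
  have "GDERIV (\<lambda>x. cos (f x)) x :> (- sin (f x)) *\<^sub>R D x" for x
    by (intro GDERIV_DERIV_compose D DERIV_cos)
  \<comment> \<open>The closure has no negation, so the sign becomes a constant factor
    \<open>-1\<close>.\<close>
  moreover have "smooth_gen (\<lambda>x. (-1) * (sin (f x) * D x $ i))" for i
    using cos.hyps D by (intro smooth_gen.mult smooth_gen.const smooth_gen.sin) auto
  ultimately show ?case
    by (intro exI[of _ "\<lambda>x. (- sin (f x)) *\<^sub>R D x"]) auto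
qed

lemma smooth_gen_imp_smooth_fun:
  assumes "smooth_gen f" shows "smooth_fun f"
  using assms
proof (coinduction arbitrary: f rule: smooth_fun.coinduct)
  case (smooth_fun f)
  then obtain D where D: "\<And>x. GDERIV f x :> D x" "\<And>i. smooth_gen (\<lambda>x. D x $ i)"
    using smooth_gen_grad by blast
  have "frechet_derivative f (at x) (axis i 1) = D x $ i" for x i
    using frechet_derivative_GDERIV[OF D(1)] by (simp add: inner_axis')
  then show ?case using D by (auto intro: GDERIV_differentiable)
qed

lemma smooth_fun_iff_smooth_gen: "smooth_fun = smooth_gen"
  using smooth_gen_imp_smooth_fun smooth_gen.base by blast

lemmas smooth_fun_intros = smooth_gen.intros(2-)[folded smooth_fun_iff_smooth_gen]

lemma smooth_fun_sum: "(\<And>i. i \<in> A \<Longrightarrow> smooth_fun (f i)) \<Longrightarrow> smooth_fun (\<lambda>x. \<Sum>i\<in>A. f i x)"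
  by (induction A rule: infinite_finite_induct) (auto intro!: smooth_fun_intros)

lemma smooth_fun_norm_sq: "smooth_fun (\<lambda>x::real^'n. (norm x)\<^sup>2)"
proof -
  have "(\<lambda>x::real^'n. (norm x)\<^sup>2) = (\<lambda>x. \<Sum>i\<in>UNIV. x $ i * x $ i)"
    by (simp add: fun_eq_iff power2_norm_eq_inner inner_vec_def)
  then show ?thesis by (simp add: smooth_fun_sum smooth_fun_intros)
qed

lemma smooth_fun_continuous: "smooth_fun f \<Longrightarrow> continuous_on S f"
  by (meson differentiable_imp_continuous_within continuous_at_imp_continuous_on smooth_fun_differentiable)

lemma smooth_fun_GDERIV: "smooth_fun f \<Longrightarrow> GDERIV f x :> grad f x"
  by (simp add: GDERIV_grad smooth_fun_differentiable)

section \<open>Test functions: stability, supports, integrability\<close>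

lemma Cc_inf_iff: "f \<in> Cc_inf \<longleftrightarrow> smooth_fun f \<and> bounded {x. f x \<noteq> 0}"
  by (simp add: Cc_inf_def compact_closure)

lemma Cc_infD: "f \<in> Cc_inf \<Longrightarrow> smooth_fun f"
  by (simp add: Cc_inf_def)

lemma Cc_infI:
  assumes "smooth_fun f" "g \<in> Cc_inf" "\<And>x. g x = 0 \<Longrightarrow> f x = 0"
  shows "f \<in> Cc_inf"
proof -
  have "{x. f x \<noteq> 0} \<subseteq> {x. g x \<noteq> 0}" using assms(3) by auto
  then show ?thesis using assms(1,2) bounded_subset by (auto simp: Cc_inf_iff)
qed

lemma Cc_inf_mult: "f \<in> Cc_inf \<Longrightarrow> smooth_fun g \<Longrightarrow> (\<lambda>x. g x * f x) \<in> Cc_inf"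
  by (rule Cc_infI[of _ f]) (auto intro: smooth_fun_intros dest: Cc_infD)

lemma Cc_inf_shift:
  assumes "f \<in> Cc_inf" shows "(\<lambda>x. f (x + a)) \<in> Cc_inf"
proof -
  have "{x. f (x + a) \<noteq> 0} = (\<lambda>x. -a + x) ` {x. f x \<noteq> 0}"
    by (auto simp: image_iff intro!: exI[of _ "_ + a"])
  moreover have "bounded ((\<lambda>x. -a + x) ` {x. f x \<noteq> 0})"
    using assms by (intro bounded_translation) (simp add: Cc_inf_iff)
  ultimately show ?thesis using assms by (simp add: Cc_inf_iff smooth_fun_intros)
qed

lemma Cc_inf_diff:
  assumes f: "f \<in> Cc_inf" and g: "g \<in> Cc_inf" shows "(\<lambda>x. f x - g x) \<in> Cc_inf"
proof -
  have s: "smooth_fun (\<lambda>x. f x + (-1) * g x)"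
    using f g by (intro smooth_fun_intros) (auto dest: Cc_infD)
  have "{x. f x - g x \<noteq> 0} \<subseteq> {x. f x \<noteq> 0} \<union> {x. g x \<noteq> 0}" by auto
  moreover have "bounded ({x. f x \<noteq> 0} \<union> {x. g x \<noteq> 0})" using f g by (simp add: Cc_inf_iff)
  ultimately have "bounded {x. f x - g x \<noteq> 0}" using bounded_subset by blast
  then show ?thesis using s by (simp add: Cc_inf_iff)
qed

lemma grad_eq_0_outside_support:
  assumes "x \<notin> closure {x. f x \<noteq> 0}" shows "grad f x = 0"
proof (rule grad_eqI)
  have "((\<lambda>x. 0) has_derivative (\<lambda>h. 0)) (at x)" by simp
  then show "GDERIV f x :> 0" unfolding gderiv_def inner_zero_right
    by (rule has_derivative_transform_within_open[where s = "- closure {x. f x \<noteq> 0}"])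
      (use assms closure_subset[of "{x. f x \<noteq> 0}"] in auto)
qed

lemma Cc_inf_grad:
  assumes "f \<in> Cc_inf" shows "(\<lambda>x. grad f x $ i) \<in> Cc_inf"
proof -
  have "{x. grad f x $ i \<noteq> 0} \<subseteq> closure {x. f x \<noteq> 0}"
    using grad_eq_0_outside_support by force
  moreover have "bounded (closure {x. f x \<noteq> 0})" using assms by (simp add: Cc_inf_iff bounded_closure)
  ultimately show ?thesis using assms bounded_subset by (auto simp: Cc_inf_iff smooth_fun_grad)
qed

lemma Cc_inf_bounded:
  assumes "f \<in> Cc_inf" obtains B where "B > 0" "\<And>x. \<bar>f x\<bar> \<le> B"
proof -
  let ?K = "closure {x. f x \<noteq> 0}"
  have "compact (f ` ?K)"
    using assms by (intro compact_continuous_image smooth_fun_continuous) (auto simp: Cc_inf_def)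
  then have "bounded (f ` ?K)" by (rule compact_imp_bounded)
  then obtain B where B: "B > 0" "\<forall>x\<in>?K. \<bar>f x\<bar> \<le> B" by (auto simp: bounded_pos)
  have "\<bar>f x\<bar> \<le> B" for x
    using B closure_subset[of "{x. f x \<noteq> 0}"] by (cases "f x = 0") auto
  then show thesis using B that by blast
qed

lemma Cc_inf_support_ball:
  assumes "f \<in> Cc_inf" obtains R where "R > 0" "\<And>x. norm x \<ge> R \<Longrightarrow> f x = 0"
proof -
  have "bounded {x. f x \<noteq> 0}" using assms by (simp add: Cc_inf_iff)
  then obtain R where "R > 0" "\<forall>x\<in>{x. f x \<noteq> 0}. norm x \<le> R" by (auto simp: bounded_pos)
  then have "f x = 0" if "norm x \<ge> R + 1" for x
    using that by force
  then show thesis using that[of "R + 1"] \<open>R > 0\<close> by simp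
qed

lemma Cc_inf_measurable: "f \<in> Cc_inf \<Longrightarrow> f \<in> borel_measurable borel"
  by (intro borel_measurable_continuous_onI smooth_fun_continuous) (auto dest: Cc_infD)

lemma Cc_inf_integrable:
  assumes "f \<in> Cc_inf" shows "integrable lborel f"
proof -
  have "integrable lborel (\<lambda>x. indicator (closure {x. f x \<noteq> 0}) x *\<^sub>R f x)"
    using assms by (intro borel_integrable_compact smooth_fun_continuous) (auto simp: Cc_inf_def)
  moreover have "(\<lambda>x. indicator (closure {x. f x \<noteq> 0}) x *\<^sub>R f x) = f"
    using closure_subset[of "{x. f x \<noteq> 0}"] by (auto simp: fun_eq_iff indicator_def)
  ultimately show ?thesis by simp
qed

lemma Cc_inf_square: "f \<in> Cc_inf \<Longrightarrow> (\<lambda>x. (f x)\<^sup>2) \<in> Cc_inf"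
  using Cc_inf_mult[of f f] by (simp add: power2_eq_square Cc_infD)

lemma grad_shift: "f \<in> Cc_inf \<Longrightarrow> grad (\<lambda>x. f (x + a)) x = grad f (x + a)"
  by (intro grad_eqI GDERIV_shift smooth_fun_GDERIV) (auto dest: Cc_infD)

lemma grad_diff: "f \<in> Cc_inf \<Longrightarrow> g \<in> Cc_inf \<Longrightarrow> grad (\<lambda>x. f x - g x) x = grad f x - grad g x"
  by (intro grad_eqI GDERIV_diff smooth_fun_GDERIV) (auto dest: Cc_infD)

lemma norm_sq_eq_sum: "(norm (v::real^'n))\<^sup>2 = (\<Sum>i\<in>UNIV. (v $ i)\<^sup>2)"
  by (simp add: power2_norm_eq_inner inner_vec_def, simp add: power2_eq_square)

lemma grad_measurable:
  assumes "f \<in> Cc_inf" shows "grad f \<in> borel_measurable borel"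
proof -
  have "continuous_on UNIV (\<lambda>x. \<chi> i. grad f x $ i)"
    using assms by (intro continuous_on_vec_lambda smooth_fun_continuous smooth_fun_grad) (auto dest: Cc_infD)
  then show ?thesis by (intro borel_measurable_continuous_onI) simp
qed

lemma Cc_inf_integrable_grad_sq:
  assumes "f \<in> Cc_inf" shows "integrable lborel (\<lambda>x. (norm (grad f x))\<^sup>2)"
  unfolding norm_sq_eq_sum
  using assms by (intro Bochner_Integration.integrable_sum Cc_inf_integrable Cc_inf_square Cc_inf_grad)

section \<open>The Dirichlet integral, translations and integration by parts\<close>

definition Dirichlet :: "(real^'n \<Rightarrow> real) \<Rightarrow> real" where
  "Dirichlet f = (\<integral>x. (norm (grad f x))\<^sup>2 \<partial>lborel)"

lemma Dirichlet_nonneg: "Dirichlet f \<ge> 0"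
  by (simp add: Dirichlet_def)

lemma integral_shift:
  fixes f :: "'a::euclidean_space \<Rightarrow> real"
  shows "(\<integral>x. f (x + a) \<partial>lborel) = (\<integral>x. f x \<partial>lborel)"
proof -
  have "(\<integral>x. f x \<partial>lborel) = (\<integral>x. f x \<partial>distr lborel borel ((+) a))"
    by (simp add: lborel_distr_plus)
  also have "\<dots> = (\<integral>x. f (a + x) \<partial>lborel)"
  proof (cases "f \<in> borel_measurable borel")
    case True then show ?thesis by (subst integral_distr) auto
  next
    \<comment> \<open>Translation preserves non-measurability, so both Bochner integrals take the
      default value 0.\<close>
    case False
    have "(\<lambda>x. f (a + x)) \<notin> borel_measurable borel"
    proof
      assume "(\<lambda>x. f (a + x)) \<in> borel_measurable borel"
      then have "(\<lambda>x. f (a + (x - a))) \<in> borel_measurable borel" by measurable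
      with False show False by simp
    qed
    with False show ?thesis by (simp add: not_integrable_integral_eq borel_measurable_integrable lborel_distr_plus)
      (metis borel_measurable_integrable measurable_lborel2 not_integrable_integral_eq)
  qed
  finally show ?thesis by (simp add: add.commute)
qed

lemma Dirichlet_shift: "f \<in> Cc_inf \<Longrightarrow> Dirichlet (\<lambda>x. f (x + a)) = Dirichlet f"
  using integral_shift[of "\<lambda>x. (norm (grad f x))\<^sup>2" a] by (simp add: Dirichlet_def grad_shift)

lemma Cc_inf_line_deriv:
  assumes "f \<in> Cc_inf"
  shows "((\<lambda>t. f (x + t *\<^sub>R v)) has_real_derivative (grad f (x + t *\<^sub>R v) \<bullet> v)) (at t)"
proof -
  have "((\<lambda>t. x + t *\<^sub>R v) has_derivative (\<lambda>h. h *\<^sub>R v)) (at t)"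
    by (auto intro!: derivative_eq_intros)
  moreover have "(f has_derivative (\<lambda>h. h \<bullet> grad f (x + t *\<^sub>R v))) (at (x + t *\<^sub>R v))"
    using smooth_fun_GDERIV[OF Cc_infD(1)[OF assms]] by (simp add: gderiv_def)
  ultimately have "((\<lambda>t. f (x + t *\<^sub>R v)) has_derivative (\<lambda>h. (h *\<^sub>R v) \<bullet> grad f (x + t *\<^sub>R v))) (at t)"
    by (rule has_derivative_compose)
  then show ?thesis by (simp add: has_field_derivative_def mult.commute inner_commute mult_commute_abs)
qed

text \<open>Difference quotients have integral zero by translation invariance, and they converge to
  the partial derivative under a common integrable bound. This serves as the integration by parts in
  Hardy's inequality.\<close>

lemma integral_partial_derivative:
  fixes f :: "real^'n \<Rightarrow> real"
  assumes f: "f \<in> Cc_inf"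
  shows "(\<integral>x. grad f x $ i \<partial>lborel) = 0"
proof -
  let ?e = "axis i 1 :: real^'n"
  define h where "h n = inverse (real (Suc n))" for n
  have h: "h n > 0" "h n \<le> 1" for n by (auto simp: h_def field_simps)
  define s where "s n x = (f (x + h n *\<^sub>R ?e) - f x) / h n" for n x
  note [measurable] = Cc_inf_measurable[OF f]
  obtain B where B: "B > 0" "\<And>x. \<bar>grad f x $ i\<bar> \<le> B" using Cc_inf_bounded[OF Cc_inf_grad[OF f]] by metis
  obtain R where R: "R > 0" "\<And>x. norm x \<ge> R \<Longrightarrow> f x = 0" using Cc_inf_support_ball[OF f] by blast
  have "(\<lambda>n. \<integral>x. s n x \<partial>lborel) \<longlonglongrightarrow> (\<integral>x. grad f x $ i \<partial>lborel)"
  proof (rule integral_dominated_convergence)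
    show "(\<lambda>x. grad f x $ i) \<in> borel_measurable lborel" using Cc_inf_measurable[OF Cc_inf_grad[OF f]] by simp
    show "s n \<in> borel_measurable lborel" for n unfolding s_def by measurable
    \<comment> \<open>The steps satisfy \<open>h n \<le> 1\<close>, so all quotients are supported
      in the ball of radius \<open>R + 1\<close>; the mean value theorem bounds them by
      \<open>B\<close>.\<close>
    show "integrable lborel (\<lambda>x. B * indicator (cball (0::real^'n) (R + 1)) x)"
      by (intro integrable_mult_right integrable_real_indicator emeasure_bounded_finite bounded_cball) simp
    show "AE x in lborel. (\<lambda>n. s n x) \<longlonglongrightarrow> grad f x $ i"
    proof (rule AE_I2)
      fix x
      have "((\<lambda>t. (f (x + t *\<^sub>R ?e) - f x) / t) \<longlongrightarrow> grad f x $ i) (at 0)"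
        using Cc_inf_line_deriv[OF f, of x ?e 0] by (simp add: DERIV_def inner_axis)
      moreover have "filterlim h (at 0) sequentially"
        unfolding filterlim_at h_def using LIMSEQ_inverse_real_of_nat by auto
      ultimately show "(\<lambda>n. s n x) \<longlonglongrightarrow> grad f x $ i"
        unfolding s_def by (rule filterlim_compose)
    qed
    show "AE x in lborel. norm (s n x) \<le> B * indicator (cball 0 (R + 1)) x" for n
    proof (rule AE_I2)
      fix x
      show "norm (s n x) \<le> B * indicator (cball 0 (R + 1)) x"
      proof (cases "norm x \<le> R + 1")
        case True
        obtain z where z: "0 < z" "z < h n" "f (x + h n *\<^sub>R ?e) - f (x + 0 *\<^sub>R ?e) = (h n - 0) * (grad f (x + z *\<^sub>R ?e) \<bullet> ?e)"
          using MVT2[OF h(1)[of n] Cc_inf_line_deriv[OF f, of x ?e]] by blast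
        then have "s n x = grad f (x + z *\<^sub>R ?e) $ i" using h(1)[of n] by (simp add: s_def inner_axis)
        then show ?thesis using B True by simp
      next
        case False
        have "norm x \<le> norm (x + h n *\<^sub>R ?e) + norm (h n *\<^sub>R ?e)" by (metis add_diff_cancel norm_triangle_ineq4)
        then have "norm (x + h n *\<^sub>R ?e) \<ge> R" using h[of n] False by simp
        then show ?thesis using R False by (simp add: s_def)
      qed
    qed
  qed
  moreover have "(\<integral>x. s n x \<partial>lborel) = 0" for n
  proof -
    have "(\<integral>x. s n x \<partial>lborel) = ((\<integral>x. f (x + h n *\<^sub>R ?e) \<partial>lborel) - (\<integral>x. f x \<partial>lborel)) / h n"
      unfolding s_def using Cc_inf_integrable[OF f] Cc_inf_integrable[OF Cc_inf_shift[OF f]] by simp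
    then show ?thesis by (simp add: integral_shift)
  qed
  ultimately show ?thesis by (simp add: LIMSEQ_const_iff)
qed

section \<open>The Sobolev inequality\<close>

text \<open>Bounding a power of \<open>G\<close> avoids roots of extended reals.\<close>

lemma nn_integral_Hoelder_root:
  fixes F :: "'i \<Rightarrow> 'a \<Rightarrow> ennreal" and G :: "'a \<Rightarrow> ennreal"
  assumes K: "finite K" "K \<noteq> {}"
    and F[measurable]: "\<And>i. i \<in> K \<Longrightarrow> F i \<in> borel_measurable M"
    and G[measurable]: "G \<in> borel_measurable M"
    and le: "\<And>x. x \<in> space M \<Longrightarrow> G x ^ card K \<le> (\<Prod>i\<in>K. F i x)"
  shows "(\<integral>\<^sup>+x. G x \<partial>M) ^ card K \<le> (\<Prod>i\<in>K. \<integral>\<^sup>+x. F i x \<partial>M)"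
proof -
  define m where "m = card K"
  have m: "m > 0" using K by (auto simp: m_def card_gt_0_iff)
  define c where "c i = (\<integral>\<^sup>+x. F i x \<partial>M)" for i
  \<comment> \<open>A zero integral forces \<open>G = 0\<close> almost everywhere. Once zeros are
    excluded, an infinite integral makes the right-hand side infinite, with no product of 0 and
    infinity. Only then can one normalise.\<close>
  consider (zero) i where "i \<in> K" "c i = 0" | (top) "\<forall>i\<in>K. c i \<noteq> 0" "\<exists>i\<in>K. c i = top"
    | (pos) "\<forall>i\<in>K. c i \<noteq> 0 \<and> c i \<noteq> top" by blast
  then show ?thesis
  proof cases
    case zero
    have "AE x in M. F i x = 0"
      using zero by (subst nn_integral_0_iff_AE[symmetric]) (auto simp: c_def)
    then have "AE x in M. G x = 0"
      using AE_space
    proof eventually_elim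
      case (elim x)
      have "(\<Prod>i\<in>K. F i x) = 0" using zero K elim by (intro prod_zero) auto
      then have "G x ^ card K = 0" using le[of x] elim by (metis le_zero_eq)
      then show ?case using m by (metis m_def power_eq_0_iff)
    qed
    then have "(\<integral>\<^sup>+x. G x \<partial>M) = 0" by (subst nn_integral_0_iff_AE) auto
    then show ?thesis using m by (simp add: m_def zero_power)
  next
    case top
    then have "(\<Prod>i\<in>K. c i) = top" using K by (simp add: ennreal_prod_eq_top)
    then show ?thesis by (simp add: c_def)
  next
    case pos
    define d where "d i = enn2real (c i)" for i
    have d: "c i = ennreal (d i)" "d i > 0" if "i \<in> K" for i
      using pos that by (auto simp: d_def enn2real_positive_iff top.not_eq_extremum zero_less_iff_neq_zero)
    \<comment> \<open>The geometric mean of the integrals. After dividing each \<open>F i\<close> by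
      its integral, the inequality of arithmetic and geometric means bounds \<open>G / D\<close> by
      an average of functions of integral 1.\<close>
    define D where "D = (\<Prod>i\<in>K. d i) powr (1/m)"
    have D: "D > 0" unfolding D_def using d(2) by (simp add: prod_pos less_imp_neq[symmetric])
    have Dm: "D ^ m = (\<Prod>i\<in>K. d i)"
      using m d(2) by (simp add: D_def powr_power prod_pos prod_nonneg less_imp_le less_imp_neq[symmetric])
    have pw: "G x \<le> ennreal D * (\<Sum>i\<in>K. F i x * ennreal (1 / (m * d i)))" if x: "x \<in> space M" for x
    proof (cases "\<exists>i\<in>K. F i x = top")
      case True
      then obtain i where i: "i \<in> K" "F i x = top" by blast
      have "F i x * ennreal (1 / (m * d i)) = top"
        using i d(2)[of i] m by (simp add: ennreal_top_mult)
      then have "(\<Sum>i\<in>K. F i x * ennreal (1 / (m * d i))) = top"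
        using i K by (meson ennreal_sum_eq_top)
      then show ?thesis using D by (simp add: ennreal_mult_top)
    next
      case False
      define f where "f i = enn2real (F i x)" for i
      have f: "F i x = ennreal (f i)" "f i \<ge> 0" if "i \<in> K" for i
        using False that by (auto simp: f_def less_top)
      have PF: "(\<Prod>i\<in>K. F i x) = ennreal (\<Prod>i\<in>K. f i)"
        using f by (simp add: prod_ennreal)
      then have "G x ^ m \<le> ennreal (\<Prod>i\<in>K. f i)" using le[OF x] by (simp add: m_def)
      then have "G x ^ m < top" using ennreal_less_top le_less_trans by blast
      then have "G x < top" using m power_less_top_ennreal by auto
      then obtain g where g: "G x = ennreal g" "g \<ge> 0" by (cases "G x") auto
      have "g ^ m \<le> (\<Prod>i\<in>K. f i)"
        using le[OF x] f g PF unfolding m_def by (simp add: ennreal_power prod_nonneg)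
      then have "(g / D) ^ m \<le> (\<Prod>i\<in>K. f i / d i)"
        using d(2) by (simp add: power_divide Dm prod_dividef divide_right_mono prod_pos prod_nonneg less_imp_le)
      then have "((g / D) ^ m) powr (1/m) \<le> (\<Prod>i\<in>K. f i / d i) powr (1/m)"
        using g D by (intro powr_mono2) auto
      moreover have "((g / D) ^ m) powr (1/m) = g / D"
        using g D m by (cases "g = 0") (auto simp: powr_powr simp flip: powr_realpow)
      moreover have "(\<Prod>i\<in>K. f i / d i) powr (1/m) \<le> (\<Sum>i\<in>K. (f i / d i) / m)"
        unfolding m_def using K f(2) d(2) by (intro arith_geom_mean) (auto simp: less_imp_le)
      ultimately have "g / D \<le> (\<Sum>i\<in>K. f i / d i / m)" by linarith
      then have "g \<le> D * (\<Sum>i\<in>K. f i * (1 / (m * d i)))"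
        using D by (simp add: field_simps)
      moreover have "(\<Sum>i\<in>K. F i x * ennreal (1 / (m * d i))) = ennreal (\<Sum>i\<in>K. f i * (1 / (m * d i)))"
      proof (subst sum_ennreal[symmetric])
        show "(\<Sum>i\<in>K. F i x * ennreal (1 / (m * d i))) = (\<Sum>i\<in>K. ennreal (f i * (1 / (m * d i))))"
          using f d(2) by (intro sum.cong refl) (simp only: ennreal_mult' f)
      qed (use f d(2) in \<open>auto simp: less_imp_le\<close>)
      ultimately show ?thesis
        using D g f d(2) by (simp add: ennreal_mult'[symmetric] ennreal_leI less_imp_le)
    qed
    have "(\<integral>\<^sup>+x. G x \<partial>M) \<le> (\<integral>\<^sup>+x. ennreal D * (\<Sum>i\<in>K. F i x * ennreal (1 / (m * d i))) \<partial>M)"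
      by (intro nn_integral_mono pw)
    also have "\<dots> = ennreal D * (\<Sum>i\<in>K. c i * ennreal (1 / (m * d i)))"
      using F by (simp add: nn_integral_cmult nn_integral_sum nn_integral_multc c_def)
    also have "(\<Sum>i\<in>K. c i * ennreal (1 / (m * d i))) = (\<Sum>i\<in>K. ennreal (1 / m))"
      using d m by (intro sum.cong refl) (simp add: ennreal_mult'[symmetric] less_imp_le less_imp_neq[symmetric])
    also have "\<dots> = 1"
      using m by (subst sum_ennreal) (auto simp: m_def)
    finally have "(\<integral>\<^sup>+x. G x \<partial>M) ^ m \<le> ennreal D ^ m" by (intro power_mono) auto
    also have "\<dots> = ennreal (\<Prod>i\<in>K. d i)" using D by (simp add: ennreal_power Dm)
    also have "\<dots> = (\<Prod>i\<in>K. c i)" using d by (simp add: prod_ennreal less_imp_le)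
    finally show ?thesis by (simp add: c_def m_def)
  qed
qed

text \<open>Integrating one coordinate at a time, with the coordinates in \<open>S\<close> already integrated; for
  \<open>S = I\<close> this is the Loomis--Whitney-type inequality behind the Sobolev embedding.\<close>

lemma Gagliardo_product:
  fixes f :: "'i \<Rightarrow> ('i \<Rightarrow> real) \<Rightarrow> ennreal" and G :: "('i \<Rightarrow> real) \<Rightarrow> ennreal"
  assumes I: "finite I" "card I = Suc m" "m > 0"
    and S: "S \<subseteq> I"
    and f: "\<And>i. i \<in> I \<Longrightarrow> f i \<in> borel_measurable (Pi\<^sub>M S (\<lambda>_. lborel))"
    and G: "G \<in> borel_measurable (Pi\<^sub>M S (\<lambda>_. lborel))"
    and le: "\<And>x. x \<in> space (Pi\<^sub>M S (\<lambda>_. lborel :: real measure)) \<Longrightarrow>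
      G x ^ m \<le> (\<Prod>i\<in>I. if i \<in> S then \<integral>\<^sup>+t. f i (x(i := t)) \<partial>lborel else f i x)"
  shows "(\<integral>\<^sup>+x. G x \<partial>Pi\<^sub>M S (\<lambda>_. lborel)) ^ m \<le> (\<Prod>i\<in>I. \<integral>\<^sup>+x. f i x \<partial>Pi\<^sub>M S (\<lambda>_. lborel))"
proof -
  interpret product_sigma_finite "\<lambda>_::'i. lborel :: real measure"
    by standard
  have "finite S" using S I finite_subset by blast
  from this S f G le show ?thesis
  proof (induction S arbitrary: f G rule: finite_induct)
    case empty
    then show ?case by (simp add: PiM_empty nn_integral_count_space_finite space_PiM)
  next
    case (insert j S)
    interpret S: finite_product_sigma_finite "\<lambda>_::'i. lborel :: real measure" S
      by standard (rule insert.hyps)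
    let ?P = "\<lambda>S. Pi\<^sub>M S (\<lambda>_. lborel :: real measure)"
    note [measurable] = insert.prems(2,3)
    have jI: "j \<in> I" "S \<subseteq> I" using insert.prems by auto
    \<comment> \<open>Once coordinate \<open>j\<close> is integrated out of its own factor, that
      factor is the same on every slice \<open>x j = y\<close>. The induction hypothesis is applied
      on each slice, with \<open>gj\<close> in place of \<open>f j\<close>.\<close>
    define gj where "gj x = (\<integral>\<^sup>+t. f j (x(j := t)) \<partial>lborel)" for x
    have [measurable]: "f j \<in> borel_measurable (?P (insert j S))" using jI by simp
    have gj[measurable]: "gj \<in> borel_measurable (?P S)"
      unfolding gj_def by measurable
    define c where "c = (\<integral>\<^sup>+x. gj x \<partial>?P S)"
    have c: "c = (\<integral>\<^sup>+x. f j x \<partial>?P (insert j S))"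
      unfolding c_def gj_def using insert.hyps by (subst product_nn_integral_insert) auto
    define h where "h y i = (if i = j then gj else (\<lambda>x. f i (x(j := y))))" for y i
    have upd: "(\<lambda>x. x(j := y)) \<in> measurable (?P S) (?P (insert j S))" for y
      by measurable
    have inner: "(\<integral>\<^sup>+x. G (x(j := y)) \<partial>?P S) ^ m \<le> (\<Prod>i\<in>I. \<integral>\<^sup>+x. h y i x \<partial>?P S)" for y
    proof (rule insert.IH[OF jI(2)])
      show "h y i \<in> borel_measurable (?P S)" if "i \<in> I" for i
        using that measurable_compose[OF upd insert.prems(2)[OF that]] by (auto simp: h_def)
      show "(\<lambda>x. G (x(j := y))) \<in> borel_measurable (?P S)"
        using measurable_compose[OF upd insert.prems(3)] .
      fix x assume x: "x \<in> space (?P S)"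
      have x': "x(j := y) \<in> space (?P (insert j S))"
        using x measurable_space[OF upd] by blast
      have "G (x(j := y)) ^ m \<le> (\<Prod>i\<in>I. if i \<in> insert j S
          then \<integral>\<^sup>+t. f i ((x(j := y))(i := t)) \<partial>lborel else f i (x(j := y)))"
        by (rule insert.prems(4)[OF x'])
      also have "\<dots> = (\<Prod>i\<in>I. if i \<in> S then \<integral>\<^sup>+t. h y i (x(i := t)) \<partial>lborel else h y i x)"
        using insert.hyps
        by (intro prod.cong refl) (auto simp: h_def gj_def fun_upd_twist)
      finally show "G (x(j := y)) ^ m \<le> \<dots>" .
    qed
    let ?K = "I - {j}"
    have K: "finite ?K" "card ?K = m" using I jI by auto
    have K0: "?K \<noteq> {}" using K(2) I(3) by (metis card.empty less_irrefl)
    \<comment> \<open>Hoelder in the variable \<open>y\<close> must have exactly \<open>m\<close>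
      factors, one for each index other than \<open>j\<close>. The constant \<open>c\<close> from
      factor \<open>j\<close> is therefore attached to an arbitrary one of them.\<close>
    obtain i0 where i0: "i0 \<in> ?K" using K0 by blast
    define F where "F i y = (if i = i0 then c else 1) * (\<integral>\<^sup>+x. f i (x(j := y)) \<partial>?P S)" for i y
    have Fm: "F i \<in> borel_measurable lborel" if "i \<in> ?K" for i
    proof -
      have [measurable]: "f i \<in> borel_measurable (?P (insert j S))" using that by simp
      show ?thesis unfolding F_def by measurable
    qed
    have prodc: "(\<Prod>i\<in>?K. (if i = i0 then c else 1) * a i) = c * (\<Prod>i\<in>?K. a i)" for a :: "'i \<Rightarrow> ennreal"
      using i0 K by (simp add: prod.distrib prod.delta)
    have "(\<integral>\<^sup>+y. (\<integral>\<^sup>+x. G (x(j := y)) \<partial>?P S) \<partial>lborel) ^ card ?K \<le> (\<Prod>i\<in>?K. \<integral>\<^sup>+y. F i y \<partial>lborel)"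
    proof (rule nn_integral_Hoelder_root[OF K(1) K0 Fm])
      show "(\<lambda>y. \<integral>\<^sup>+x. G (x(j := y)) \<partial>?P S) \<in> borel_measurable lborel" by measurable
      show "(\<integral>\<^sup>+x. G (x(j := y)) \<partial>?P S) ^ card ?K \<le> (\<Prod>i\<in>?K. F i y)" for y
      proof -
        have "(\<Prod>i\<in>I. \<integral>\<^sup>+x. h y i x \<partial>?P S) = c * (\<Prod>i\<in>?K. \<integral>\<^sup>+x. f i (x(j := y)) \<partial>?P S)"
          using I jI by (subst prod.remove[of _ j]) (auto simp: h_def c_def intro!: prod.cong)
        then show ?thesis using inner[of y] unfolding F_def prodc K by simp
      qed
    qed
    also have "(\<Prod>i\<in>?K. \<integral>\<^sup>+y. F i y \<partial>lborel)
      = (\<Prod>i\<in>?K. (if i = i0 then c else 1) * (\<integral>\<^sup>+x. f i x \<partial>?P (insert j S)))"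
    proof (intro prod.cong refl)
      fix i assume i: "i \<in> ?K"
      then have [measurable]: "f i \<in> borel_measurable (?P (insert j S))" by simp
      show "(\<integral>\<^sup>+y. F i y \<partial>lborel) = (if i = i0 then c else 1) * (\<integral>\<^sup>+x. f i x \<partial>?P (insert j S))"
        unfolding F_def using insert.hyps
        by (subst nn_integral_cmult) (auto simp: product_nn_integral_insert_rev)
    qed
    also have "\<dots> = c * (\<Prod>i\<in>?K. \<integral>\<^sup>+x. f i x \<partial>?P (insert j S))" by (rule prodc)
    also have "\<dots> = (\<Prod>i\<in>I. \<integral>\<^sup>+x. f i x \<partial>?P (insert j S))"
      using I jI c by (subst (2) prod.remove[of _ j]) auto
    finally show ?case
      using insert.hyps K by (simp add: product_nn_integral_insert_rev)
  qed
qed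

section \<open>Powers of absolute values along lines\<close>

lemma has_real_derivative_abs_powr:
  fixes y :: real
  assumes "p > 1"
  shows "((\<lambda>y. \<bar>y\<bar> powr p) has_real_derivative (p * \<bar>y\<bar> powr (p - 1) * sgn y)) (at y)"
proof -
  consider "y > 0" | "y < 0" | "y = 0" by linarith
  then show ?thesis
  proof cases
    case 1
    have "((\<lambda>y. y powr p) has_real_derivative (p * y powr (p - 1))) (at y)"
      using 1 by (rule has_real_derivative_powr)
    then have "((\<lambda>y. \<bar>y\<bar> powr p) has_real_derivative (p * y powr (p - 1))) (at y)"
      by (rule has_field_derivative_transform_within_open[where S = "{0<..}"]) (use 1 in auto)
    with 1 show ?thesis by simp
  next
    case 2
    have "((\<lambda>y. (-y) powr p) has_real_derivative (p * (-y) powr (p - 1) * (-1))) (at y)"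
      using 2 by (auto intro!: derivative_eq_intros DERIV_fun_powr)
    then have "((\<lambda>y. \<bar>y\<bar> powr p) has_real_derivative (p * (-y) powr (p - 1) * (-1))) (at y)"
      by (rule has_field_derivative_transform_within_open[where S = "{..<0}"]) (use 2 in auto)
    with 2 show ?thesis by simp
  next
    case 3
    \<comment> \<open>At a zero the difference quotient has size \<open>|h| powr (p - 1)\<close>,
      which tends to 0 because \<open>p > 1\<close>.\<close>
    have "((\<lambda>h::real. \<bar>h\<bar> powr (p - 1)) \<longlongrightarrow> \<bar>0\<bar> powr (p - 1)) (at 0)"
      using assms by (intro tendsto_powr' tendsto_intros) auto
    then have "((\<lambda>h::real. \<bar>h\<bar> powr (p - 1)) \<longlongrightarrow> 0) (at 0)" by simp
    then have "((\<lambda>h::real. \<bar>h\<bar> powr p / h) \<longlongrightarrow> 0) (at 0)"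
    proof (rule Lim_null_comparison[rotated])
      have "norm (\<bar>h\<bar> powr p / h) = \<bar>h\<bar> powr (p - 1)" if "h \<noteq> 0" for h :: real
        using that by (simp add: powr_diff abs_mult)
      then show "\<forall>\<^sub>F h in at 0. norm (\<bar>h\<bar> powr p / h) \<le> \<bar>h\<bar> powr (p - 1)"
        by (auto simp: eventually_at_filter)
    qed
    then show ?thesis using 3 assms by (simp add: DERIV_def)
  qed
qed

lemma isCont_abs_powr_sgn:
  fixes y :: real
  assumes "p > 0"
  shows "isCont (\<lambda>y. \<bar>y\<bar> powr p * sgn y) y"
proof (cases "y = 0")
  case True
  have "((\<lambda>h::real. \<bar>h\<bar> powr p) \<longlongrightarrow> \<bar>0\<bar> powr p) (at 0)"
    using assms by (intro tendsto_powr' tendsto_intros) auto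
  then have "((\<lambda>h::real. \<bar>h\<bar> powr p) \<longlongrightarrow> 0) (at 0)" by simp
  then have "((\<lambda>h::real. \<bar>h\<bar> powr p * sgn h) \<longlongrightarrow> 0) (at 0)"
    by (rule Lim_null_comparison[rotated]) (auto simp: abs_mult sgn_if eventually_at_filter)
  then show ?thesis using True by (simp add: isCont_def)
next
  case False
  then have "isCont sgn y" by (simp add: isCont_def tendsto_sgn)
  then show ?thesis using False by (intro continuous_intros) auto
qed

text \<open>For \<open>p > 1\<close> the power is continuously differentiable across the zeros of
  \<open>g\<close>, since the factor \<open>|g| powr (p - 1)\<close> removes the jump of the sign.
  So the fundamental theorem of calculus applies without smoothing the absolute value.\<close>

lemma abs_powr_le_nn_integral:
  fixes g g' :: "real \<Rightarrow> real"
  assumes p: "p > 1" and g: "\<And>t. (g has_real_derivative g' t) (at t)"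
    and g': "\<And>t. isCont g' t" and ab: "a \<le> b" and ga: "g a = 0"
  shows "ennreal (\<bar>g b\<bar> powr p) \<le> (\<integral>\<^sup>+t. ennreal (p * \<bar>g t\<bar> powr (p - 1) * \<bar>g' t\<bar>) \<partial>lborel)"
proof -
  define h where "h t = p * (\<bar>g t\<bar> powr (p - 1) * sgn (g t)) * g' t" for t
  have cg: "isCont g t" for t using g DERIV_isCont by blast
  have D: "((\<lambda>t. \<bar>g t\<bar> powr p) has_real_derivative h t) (at t)" for t
    using DERIV_chain2[OF has_real_derivative_abs_powr[OF p] g, of t] by (simp add: h_def mult.assoc)
  have cs: "isCont (\<lambda>t. \<bar>g t\<bar> powr (p - 1) * sgn (g t)) t" for t
    using isCont_o2[OF cg isCont_abs_powr_sgn, of "p - 1"] p by simp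
  have c: "isCont h t" for t
    unfolding h_def by (rule isCont_mult[OF isCont_mult[OF continuous_const cs] g'])
  have I: "integrable lborel (\<lambda>t. h t * indicator {a..b} t)"
    using borel_integrable_atLeastAtMost'[of a b h] c
    by (simp add: set_integrable_def mult.commute continuous_at_imp_continuous_on)
  have "(\<integral>t. h t * indicator {a..b} t \<partial>lborel) = \<bar>g b\<bar> powr p - \<bar>g a\<bar> powr p"
    by (rule integral_FTC_Icc_real[OF ab]) (use D c in \<open>auto\<close>)
  then have "\<bar>g b\<bar> powr p = norm (\<integral>t. h t * indicator {a..b} t \<partial>lborel)"
    using p ga by simp
  then have "ennreal (\<bar>g b\<bar> powr p) = ennreal (norm (\<integral>t. h t * indicator {a..b} t \<partial>lborel))"
    by (rule arg_cong)
  also have "\<dots> \<le> (\<integral>\<^sup>+t. norm (h t * indicator {a..b} t) \<partial>lborel)"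
    by (rule integral_norm_bound_ennreal[OF I])
  also have "\<dots> \<le> (\<integral>\<^sup>+t. ennreal (p * \<bar>g t\<bar> powr (p - 1) * \<bar>g' t\<bar>) \<partial>lborel)"
    using p by (intro nn_integral_mono ennreal_leI) (auto simp: h_def abs_mult indicator_def sgn_if)
  finally show ?thesis .
qed

text \<open>The \<open>L\<^sup>1\<close> Sobolev inequality applied to \<open>|f| powr p\<close>.\<close>

lemma Cc_inf_Gagliardo_Nirenberg:
  fixes f :: "real^'n \<Rightarrow> real" and p q :: real
  assumes f: "f \<in> Cc_inf" and N: "CARD('n) \<ge> 3" and p: "p > 1" and pq: "p * CARD('n) = q * (CARD('n) - 1)"
  shows "(\<integral>\<^sup>+x. ennreal (\<bar>f x\<bar> powr q) \<partial>lborel) ^ (CARD('n) - 1)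
    \<le> (\<integral>\<^sup>+x. ennreal (p * \<bar>f x\<bar> powr (p - 1) * norm (grad f x)) \<partial>lborel) ^ CARD('n)"
proof -
  note [measurable] = Cc_inf_measurable[OF f] grad_measurable[OF f]
  define m where "m = CARD('n) - 1"
  let ?B = "Basis :: (real^'n) set"
  let ?P = "Pi\<^sub>M ?B (\<lambda>_. lborel :: real measure)"
  \<comment> \<open>Lebesgue measure is the image under \<open>T\<close> of the product measure over
    the basis, which exposes the coordinates to be integrated one by one.\<close>
  define T where "T x = (\<Sum>b\<in>?B. x b *\<^sub>R b)" for x
  have T[measurable]: "T \<in> measurable ?P borel" unfolding T_def by measurable
  have L: "(lborel :: (real^'n) measure) = distr ?P borel T"
    unfolding T_def by (rule lborel_eq)
  have nn: "(\<integral>\<^sup>+x. F x \<partial>lborel) = (\<integral>\<^sup>+x. F (T x) \<partial>?P)" if "F \<in> borel_measurable borel" for F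
    unfolding L using that by (subst nn_integral_distr) auto
  define F where "F b x = ennreal (p * \<bar>f x\<bar> powr (p - 1) * \<bar>grad f x \<bullet> b\<bar>)" for b x
  have F[measurable]: "F b \<in> borel_measurable borel" for b unfolding F_def by measurable
  obtain R where R: "R > 0" "\<And>x. norm x \<ge> R \<Longrightarrow> f x = 0" using Cc_inf_support_ball[OF f] by blast
  have line: "ennreal (\<bar>f (T x)\<bar> powr p) \<le> (\<integral>\<^sup>+t. F b (T (x(b := t))) \<partial>lborel)" if b: "b \<in> ?B" for x b
  proof -
    define z where "z = T (x(b := 0))"
    have Tz: "T (x(b := t)) = z + t *\<^sub>R b" for t
      using b by (simp add: z_def T_def sum.remove[of ?B b])
    have Tx: "T x = z + x b *\<^sub>R b" using Tz[of "x b"] by simp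
    \<comment> \<open>A starting point on the line that is not to the right of \<open>x b\<close>
      and so far out that \<open>f\<close> vanishes there.\<close>
    define a where "a = min (x b) (- (R + norm z))"
    have "norm (z + a *\<^sub>R b) \<ge> \<bar>a\<bar> - norm z"
      using norm_triangle_ineq2[of "a *\<^sub>R b" "-z"] b by (simp add: add.commute)
    moreover have "\<bar>a\<bar> \<ge> R + norm z" "a \<le> x b" using R by (auto simp: a_def min_def)
    ultimately have a: "f (z + a *\<^sub>R b) = 0" "a \<le> x b" using R by auto
    have "ennreal (\<bar>f (z + x b *\<^sub>R b)\<bar> powr p)
      \<le> (\<integral>\<^sup>+t. ennreal (p * \<bar>f (z + t *\<^sub>R b)\<bar> powr (p - 1) * \<bar>grad f (z + t *\<^sub>R b) \<bullet> b\<bar>) \<partial>lborel)"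
    proof (rule abs_powr_le_nn_integral[where g = "\<lambda>t. f (z + t *\<^sub>R b)", OF p Cc_inf_line_deriv[OF f, of z b] _ a(2,1)])
      have "continuous_on UNIV (\<lambda>t. \<Sum>i\<in>UNIV. grad f (z + t *\<^sub>R b) $ i * b $ i)"
      proof (intro continuous_on_sum continuous_on_mult continuous_on_const)
        show "continuous_on UNIV (\<lambda>t. grad f (z + t *\<^sub>R b) $ i)" for i
          by (rule continuous_on_compose2[OF smooth_fun_continuous[OF smooth_fun_grad[OF Cc_infD[OF f]]]])
            (auto intro!: continuous_intros)
      qed
      then show "isCont (\<lambda>t. grad f (z + t *\<^sub>R b) \<bullet> b) t" for t
        by (simp add: inner_vec_def continuous_on_eq_continuous_at)
    qed
    then show ?thesis by (simp add: F_def Tz Tx)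
  qed
  have G: "(\<integral>\<^sup>+x. ennreal (\<bar>f (T x)\<bar> powr q) \<partial>?P) ^ m \<le> (\<Prod>b\<in>?B. \<integral>\<^sup>+x. F b (T x) \<partial>?P)"
  proof (rule Gagliardo_product)
    show "card ?B = Suc m" "m > 0" using N by (auto simp: m_def)
    fix x
    \<comment> \<open>By \<open>pq\<close> the left side is a product of \<open>N\<close> copies of
      \<open>|f| powr p\<close>, and each copy is estimated along a different coordinate
      direction.\<close>
    have "ennreal (\<bar>f (T x)\<bar> powr q) ^ m = ennreal (\<bar>f (T x)\<bar> powr p) ^ CARD('n)"
    proof (cases "f (T x) = 0")
      case True
      then show ?thesis using N by (simp add: m_def zero_power)
    next
      case False
      have "(\<bar>f (T x)\<bar> powr q) ^ m = \<bar>f (T x)\<bar> powr (q * m)"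
        using False by (simp add: powr_power mult.commute)
      also have "q * m = p * CARD('n)" using pq N by (simp add: m_def of_nat_diff)
      also have "\<bar>f (T x)\<bar> powr (p * CARD('n)) = (\<bar>f (T x)\<bar> powr p) ^ CARD('n)"
        using False by (simp add: powr_power mult.commute)
      finally show ?thesis by (simp add: ennreal_power)
    qed
    also have "\<dots> = (\<Prod>b\<in>?B. ennreal (\<bar>f (T x)\<bar> powr p))" by simp
    also have "\<dots> \<le> (\<Prod>b\<in>?B. \<integral>\<^sup>+t. F b (T (x(b := t))) \<partial>lborel)"
      by (intro prod_mono_ennreal line)
    finally show "ennreal (\<bar>f (T x)\<bar> powr q) ^ m
      \<le> (\<Prod>b\<in>?B. if b \<in> ?B then \<integral>\<^sup>+t. F b (T (x(b := t))) \<partial>lborel else F b (T x))" by simp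
  qed (auto intro!: finite_Basis)
  also have "(\<Prod>b\<in>?B. \<integral>\<^sup>+x. F b (T x) \<partial>?P) \<le> (\<Prod>b\<in>?B. \<integral>\<^sup>+x. ennreal (p * \<bar>f x\<bar> powr (p - 1) * norm (grad f x)) \<partial>lborel)"
  proof (rule prod_mono_ennreal)
    fix b assume b: "b \<in> ?B"
    have "(\<integral>\<^sup>+x. F b (T x) \<partial>?P) = (\<integral>\<^sup>+x. F b x \<partial>lborel)" by (simp add: nn)
    also have "\<dots> \<le> (\<integral>\<^sup>+x. ennreal (p * \<bar>f x\<bar> powr (p - 1) * norm (grad f x)) \<partial>lborel)"
      unfolding F_def using p Basis_le_norm[OF b]
      by (intro nn_integral_mono ennreal_leI mult_left_mono) (auto intro: Basis_le_norm[OF b])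
    finally show "(\<integral>\<^sup>+x. F b (T x) \<partial>?P) \<le> \<dots>" .
  qed
  also have "\<dots> = (\<integral>\<^sup>+x. ennreal (p * \<bar>f x\<bar> powr (p - 1) * norm (grad f x)) \<partial>lborel) ^ CARD('n)" by simp
  finally show ?thesis by (subst nn) (auto simp: m_def)
qed

section \<open>From the product estimate to potentials in L^(N/2)\<close>

lemma nn_integral_grad_sq: "f \<in> Cc_inf \<Longrightarrow> (\<integral>\<^sup>+x. ennreal ((norm (grad f x))\<^sup>2) \<partial>lborel) = ennreal (Dirichlet f)"
  by (simp add: Dirichlet_def nn_integral_eq_integral Cc_inf_integrable_grad_sq)

lemma ennreal_power_le_imp_le:
  assumes "x ^ n \<le> ennreal r ^ n" "r \<ge> 0" "n > 0"
  shows "x \<le> ennreal r"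
proof -
  have "x ^ n < top" using assms(1,2) by (simp add: ennreal_power le_less_trans[OF _ ennreal_less_top])
  then have "x < top" using assms(3) power_less_top_ennreal by auto
  then obtain a where a: "x = ennreal a" "a \<ge> 0" by (cases x) auto
  then have "a ^ n \<le> r ^ n" using assms by (simp add: ennreal_power)
  then have "a \<le> r" using assms a by (simp add: power_mono_iff)
  then show ?thesis using a by (simp add: ennreal_leI)
qed

text \<open>The exponent is chosen so that \<open>2 * (p - 1) = q\<close>. Cauchy-Schwarz then
  brings back the integral \<open>A\<close> of the left side, and
  \<open>A ^ (2 * (N - 1)) \<le> A ^ N * (p^2 * Dirichlet f) ^ N\<close> can be divided by
  \<open>A ^ N\<close>.\<close>

lemma Cc_inf_Sobolev:
  fixes f :: "real^'n \<Rightarrow> real"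
  assumes f: "f \<in> Cc_inf" and N: "CARD('n) \<ge> 3"
  defines "p \<equiv> 2 * (real CARD('n) - 1) / (real CARD('n) - 2)"
    and "q \<equiv> 2 * real CARD('n) / (real CARD('n) - 2)"
  shows "(\<integral>\<^sup>+x. ennreal (\<bar>f x\<bar> powr q) \<partial>lborel) ^ (CARD('n) - 2) \<le> ennreal (p\<^sup>2 * Dirichlet f) ^ CARD('n)"
proof -
  note [measurable] = Cc_inf_measurable[OF f] grad_measurable[OF f]
  let ?N = "CARD('n)"
  define A where "A = (\<integral>\<^sup>+x. ennreal (\<bar>f x\<bar> powr q) \<partial>lborel)"
  define M where "M = (\<integral>\<^sup>+x. ennreal (\<bar>f x\<bar> powr (p - 1)) * ennreal (norm (grad f x)) \<partial>lborel)"
  have p: "p > 1" and q: "q > 0" using N by (auto simp: p_def q_def field_simps)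
  have pq: "p * ?N = q * (?N - 1)" and pq2: "2 * (p - 1) = q"
    using N by (auto simp: p_def q_def field_simps of_nat_diff)
  obtain B where B: "B > 0" "\<And>x. \<bar>f x\<bar> \<le> B" using Cc_inf_bounded[OF f] by blast
  obtain R where R: "R > 0" "\<And>x. norm x \<ge> R \<Longrightarrow> f x = 0" using Cc_inf_support_ball[OF f] by blast
  \<comment> \<open>Finiteness of \<open>A\<close>, from boundedness and bounded support, is what
    permits the cancellation at the end.\<close>
  have "A \<le> (\<integral>\<^sup>+x. ennreal (B powr q) * indicator (cball (0::real^'n) R) x \<partial>lborel)"
    unfolding A_def using B R q by (intro nn_integral_mono) (auto simp: indicator_def intro!: ennreal_leI powr_mono2)
  also have "\<dots> = ennreal (B powr q) * emeasure lborel (cball (0::real^'n) R)"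
    by (subst nn_integral_cmult_indicator) auto
  also have "\<dots> < \<infinity>"
    using emeasure_bounded_finite[OF bounded_cball, of "0::real^'n" R] by (simp add: ennreal_mult_less_top)
  finally have A: "A < \<infinity>" .
  have "(\<integral>\<^sup>+x. ennreal (p * \<bar>f x\<bar> powr (p - 1) * norm (grad f x)) \<partial>lborel) = ennreal p * M"
    unfolding M_def using p
    by (subst nn_integral_cmult[symmetric]) (auto intro!: nn_integral_cong simp: ennreal_mult' mult.assoc)
  then have 1: "A ^ (?N - 1) \<le> (ennreal p * M) ^ ?N"
    using Cc_inf_Gagliardo_Nirenberg[OF f N p pq] by (simp add: A_def)
  have "M\<^sup>2 \<le> (\<integral>\<^sup>+x. ennreal (\<bar>f x\<bar> powr (p - 1)) ^ 2 \<partial>lborel) * (\<integral>\<^sup>+x. ennreal (norm (grad f x)) ^ 2 \<partial>lborel)"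
    unfolding M_def by (rule Cauchy_Schwarz_nn_integral) measurable
  also have "(\<integral>\<^sup>+x. ennreal (\<bar>f x\<bar> powr (p - 1)) ^ 2 \<partial>lborel) = A"
    unfolding A_def by (intro nn_integral_cong) (simp add: ennreal_power, simp add: power2_eq_square powr_add[symmetric] pq2[symmetric])
  also have "(\<integral>\<^sup>+x. ennreal (norm (grad f x)) ^ 2 \<partial>lborel) = ennreal (Dirichlet f)"
    using nn_integral_grad_sq[OF f] by (simp add: ennreal_power)
  finally have 2: "M\<^sup>2 \<le> A * ennreal (Dirichlet f)" .
  have "A ^ ?N * A ^ (?N - 2) = (A ^ (?N - 1))\<^sup>2"
  proof -
    have "?N + (?N - 2) = (?N - 1) * 2" using N by linarith
    then show ?thesis by (simp only: power_add[symmetric] power_mult[symmetric])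
  qed
  also have "\<dots> \<le> ((ennreal p * M) ^ ?N)\<^sup>2" by (intro power_mono 1) auto
  also have "\<dots> = (ennreal (p\<^sup>2) * M\<^sup>2) ^ ?N"
    using p by (simp add: ennreal_power[symmetric] power_mult_distrib power_mult[symmetric] mult.commute)
  also have "\<dots> \<le> (ennreal (p\<^sup>2) * (A * ennreal (Dirichlet f))) ^ ?N"
    by (intro power_mono mult_left_mono 2) auto
  also have "\<dots> = A ^ ?N * ennreal (p\<^sup>2 * Dirichlet f) ^ ?N"
    by (subst ennreal_mult') (simp_all add: power_mult_distrib mult_ac)
  finally have 3: "A ^ ?N * A ^ (?N - 2) \<le> A ^ ?N * ennreal (p\<^sup>2 * Dirichlet f) ^ ?N" .
  show ?thesis
  proof (cases "A = 0")
    case True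
    then show ?thesis using N by (simp add: A_def[symmetric] zero_power)
  next
    case False
    then have "A ^ ?N \<noteq> 0" "A ^ ?N \<noteq> top" using A by (auto simp: power_eq_top_ennreal)
    then show ?thesis using 3 unfolding A_def[symmetric]
      by (simp add: ennreal_mult_le_mult_iff)
  qed
qed

text \<open>Hoelder with exponents N/2 and N/(N - 2), written with integer multiplicities: of
  \<open>N\<close> factors, two are \<open>|W| powr (N/2)\<close> and the other \<open>N - 2\<close>
  are \<open>|f| powr q\<close>.\<close>

lemma Cc_inf_Sobolev_potential:
  fixes f W :: "real^'n \<Rightarrow> real"
  assumes f: "f \<in> Cc_inf" and N: "CARD('n) \<ge> 3" and W[measurable]: "W \<in> borel_measurable borel"
    and I: "integrable lborel (\<lambda>x. \<bar>W x\<bar> powr (real CARD('n) / 2))"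
  defines "p \<equiv> 2 * (real CARD('n) - 1) / (real CARD('n) - 2)"
  shows "(\<integral>\<^sup>+x. ennreal (\<bar>W x\<bar> * (f x)\<^sup>2) \<partial>lborel)
    \<le> ennreal (p\<^sup>2 * (\<integral>x. \<bar>W x\<bar> powr (real CARD('n) / 2) \<partial>lborel) powr (2 / CARD('n)) * Dirichlet f)"
proof -
  note [measurable] = Cc_inf_measurable[OF f]
  let ?N = "CARD('n)"
  define q where "q = 2 * real ?N / (real ?N - 2)"
  define w where "w = (\<integral>x. \<bar>W x\<bar> powr (real ?N / 2) \<partial>lborel)"
  have w: "w \<ge> 0" by (simp add: w_def)
  define F where "F i x = (if i < (2::nat) then ennreal (\<bar>W x\<bar> powr (real ?N / 2)) else ennreal (\<bar>f x\<bar> powr q))" for i x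
  have prod2: "(\<Prod>i<?N. if i < 2 then a else b) = a\<^sup>2 * b ^ (?N - 2)" for a b :: ennreal
  proof -
    have "(\<Prod>i<?N. if i < 2 then a else b) = (\<Prod>i\<in>{..<2} \<union> {2..<?N}. if i < 2 then a else b)"
      using N by (intro prod.cong) auto
    also have "\<dots> = a\<^sup>2 * b ^ (?N - 2)"
      by (subst prod.union_disjoint) auto
    finally show ?thesis .
  qed
  have "(\<integral>\<^sup>+x. ennreal (\<bar>W x\<bar> * (f x)\<^sup>2) \<partial>lborel) ^ card {..<?N} \<le> (\<Prod>i<?N. \<integral>\<^sup>+x. F i x \<partial>lborel)"
  proof (rule nn_integral_Hoelder_root)
    show "F i \<in> borel_measurable lborel" for i unfolding F_def by simp
    show "ennreal (\<bar>W x\<bar> * (f x)\<^sup>2) ^ card {..<?N} \<le> (\<Prod>i<?N. F i x)" for x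
    proof (cases "W x = 0 \<or> f x = 0")
      case True
      then show ?thesis by (auto simp: zero_power)
    next
      case False
      have "(\<bar>W x\<bar> * (f x)\<^sup>2) ^ ?N = \<bar>W x\<bar> ^ ?N * \<bar>f x\<bar> ^ (2 * ?N)"
        by (simp add: power_mult_distrib power_mult)
      also have "\<bar>W x\<bar> ^ ?N = (\<bar>W x\<bar> powr (real ?N / 2))\<^sup>2"
        using False by (simp add: powr_power powr_realpow)
      also have "\<bar>f x\<bar> ^ (2 * ?N) = (\<bar>f x\<bar> powr q) ^ (?N - 2)"
      proof -
        have "(\<bar>f x\<bar> powr q) ^ (?N - 2) = \<bar>f x\<bar> powr (q * real (?N - 2))"
          using False by (simp add: powr_power mult.commute)
        also have "q * real (?N - 2) = real (2 * ?N)" using N by (simp add: q_def of_nat_diff)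
        also have "\<bar>f x\<bar> powr real (2 * ?N) = \<bar>f x\<bar> ^ (2 * ?N)" using False by (intro powr_realpow) auto
        finally show ?thesis by simp
      qed
      finally show ?thesis unfolding F_def prod2
        by (simp add: ennreal_power flip: ennreal_mult)
    qed
  qed (use N in \<open>auto simp: lessThan_empty_iff\<close>)
  also have "(\<Prod>i<?N. \<integral>\<^sup>+x. F i x \<partial>lborel) = (\<Prod>i<?N. if i < 2 then ennreal w else \<integral>\<^sup>+x. ennreal (\<bar>f x\<bar> powr q) \<partial>lborel)"
    unfolding F_def w_def using I by (intro prod.cong refl) (simp add: nn_integral_eq_integral)
  also have "\<dots> = (ennreal w)\<^sup>2 * (\<integral>\<^sup>+x. ennreal (\<bar>f x\<bar> powr q) \<partial>lborel) ^ (?N - 2)" by (rule prod2)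
  also have "\<dots> \<le> (ennreal w)\<^sup>2 * ennreal (p\<^sup>2 * Dirichlet f) ^ ?N"
    unfolding p_def q_def by (intro mult_left_mono Cc_inf_Sobolev[OF f N]) auto
  also have "(ennreal w)\<^sup>2 = ennreal (w powr (2 / ?N)) ^ ?N"
    using w N by (cases "w = 0") (auto simp: ennreal_power powr_power powr_numeral zero_power)
  also have "\<dots> * ennreal (p\<^sup>2 * Dirichlet f) ^ ?N = ennreal (p\<^sup>2 * w powr (2 / ?N) * Dirichlet f) ^ ?N"
  proof -
    have "ennreal (w powr (2 / ?N)) * ennreal (p\<^sup>2 * Dirichlet f) = ennreal (p\<^sup>2 * w powr (2 / ?N) * Dirichlet f)"
      by (subst ennreal_mult'[symmetric]) (simp_all add: mult_ac)
    then show ?thesis by (simp add: power_mult_distrib[symmetric])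
  qed
  finally have "(\<integral>\<^sup>+x. ennreal (\<bar>W x\<bar> * (f x)\<^sup>2) \<partial>lborel) ^ ?N \<le> ennreal (p\<^sup>2 * w powr (2 / ?N) * Dirichlet f) ^ ?N"
    by simp
  then show ?thesis
    unfolding w_def by (rule ennreal_power_le_imp_le) (simp_all add: Dirichlet_nonneg)
qed

section \<open>Hardy's inequality\<close>

text \<open>The field x / (|x|^2 + s) is smooth, so its product with \<open>f^2\<close> has compact
  support and its divergence integrates to zero. Adding a multiple of that divergence to
  \<open>|grad f|^2\<close> gives a pointwise bound by completing a square.\<close>

lemma Hardy_regularized:
  fixes f :: "real^'n \<Rightarrow> real"
  assumes f: "f \<in> Cc_inf" and s: "s > 0" and N: "CARD('n) \<ge> 3"
  shows "((real CARD('n) - 2) / 2)\<^sup>2 * (\<integral>x. (f x)\<^sup>2 / ((norm x)\<^sup>2 + s) \<partial>lborel) \<le> Dirichlet f"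
proof -
  define N where "N = real CARD('n)"
  \<comment> \<open>This value maximises \<open>b * (N - 2) - b^2\<close>, the coefficient that
    survives after the square is completed; the maximum is the sharp constant.\<close>
  define b where "b = (N - 2) / 2"
  have b: "b > 0" using N by (simp add: b_def N_def)
  define w where "w x = inverse ((norm x)\<^sup>2 + s)" for x :: "real^'n"
  have pos: "(norm x)\<^sup>2 + s > 0" for x :: "real^'n" using s by (simp add: add_nonneg_pos)
  have wpos: "w x > 0" for x using pos by (simp add: w_def)
  have sw: "smooth_fun w"
  proof -
    have "smooth_fun (\<lambda>x::real^'n. ((norm x)\<^sup>2 + s) powr (-1))"
      using pos by (intro smooth_fun_intros smooth_fun_norm_sq)
    moreover have "((norm x)\<^sup>2 + s) powr (-1) = w x" for x :: "real^'n"
      using pos[of x] by (simp add: w_def powr_minus)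
    ultimately show ?thesis by simp
  qed
  have gw: "GDERIV w x :> (- 2 * (w x)\<^sup>2) *\<^sub>R x" for x
  proof -
    have "GDERIV (\<lambda>x. (norm x)\<^sup>2 + s) x :> 2 *\<^sub>R x"
      unfolding gderiv_def power2_norm_eq_inner
      by (auto intro!: derivative_eq_intros simp: inner_commute)
    from GDERIV_inverse[OF this less_imp_neq[OF pos, symmetric]] show ?thesis
      by (simp add: w_def[abs_def] mult.commute)
  qed
  have fs: "smooth_fun f" using f by (rule Cc_infD)
  define psi where "psi i x = (x $ i * w x) * (f x)\<^sup>2" for i x
  have psi: "psi i \<in> Cc_inf" for i
    unfolding psi_def by (intro Cc_inf_mult Cc_inf_square f smooth_fun_intros sw)
  have dpsi: "grad (psi i) x $ i = w x * (f x)\<^sup>2 - 2 * (w x)\<^sup>2 * (x $ i)\<^sup>2 * (f x)\<^sup>2 + 2 * w x * f x * (x $ i * grad f x $ i)" for i x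
  proof -
    have "GDERIV (psi i) x :> (x $ i * w x) *\<^sub>R (f x *\<^sub>R grad f x + f x *\<^sub>R grad f x)
        + (f x * f x) *\<^sub>R (x $ i *\<^sub>R ((- 2 * (w x)\<^sup>2) *\<^sub>R x) + w x *\<^sub>R axis i 1)"
      unfolding psi_def power2_eq_square[of "f _"]
      by (intro GDERIV_mult GDERIV_component gw smooth_fun_GDERIV[OF fs])
    from arg_cong[OF grad_eqI[OF this], of "\<lambda>v. v $ i"] show ?thesis
      by (simp add: power2_eq_square algebra_simps)
  qed
  define S where "S x = (\<Sum>i\<in>UNIV. grad (psi i) x $ i)" for x
  have S: "S x = N * w x * (f x)\<^sup>2 - 2 * (w x)\<^sup>2 * (norm x)\<^sup>2 * (f x)\<^sup>2 + 2 * w x * f x * (x \<bullet> grad f x)" for x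
    unfolding S_def dpsi
    by (simp add: sum.distrib sum_subtractf sum_distrib_left[symmetric] sum_distrib_right[symmetric] N_def norm_sq_eq_sum inner_vec_def algebra_simps)
      (simp add: sum_distrib_left mult_ac)
  have iS: "integrable lborel S" and zS: "(\<integral>x. S x \<partial>lborel) = 0"
    unfolding S_def
    by (auto simp: integral_partial_derivative[OF psi] intro!: Cc_inf_integrable Cc_inf_grad psi
        Bochner_Integration.integrable_sum)
       (subst Bochner_Integration.integral_sum; auto simp: integral_partial_derivative[OF psi] intro!: Cc_inf_integrable Cc_inf_grad psi)
  have wf: "integrable lborel (\<lambda>x. w x * (f x)\<^sup>2)"
    by (intro Cc_inf_integrable Cc_inf_mult Cc_inf_square f sw)
  have pw: "b\<^sup>2 * (w x * (f x)\<^sup>2) \<le> (norm (grad f x))\<^sup>2 + b * S x" for x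
  proof -
    \<comment> \<open>The only effect of the regularisation, and its sign is favourable.\<close>
    have wn: "(w x)\<^sup>2 * (norm x)\<^sup>2 \<le> w x"
    proof -
      have "w x * (norm x)\<^sup>2 \<le> 1" using pos[of x] s by (simp add: w_def divide_simps)
      from mult_left_mono[OF this, of "w x"] wpos[of x] show ?thesis by (simp add: power2_eq_square mult_ac)
    qed
    have "0 \<le> (norm (grad f x + (b * w x * f x) *\<^sub>R x))\<^sup>2" by simp
    also have "\<dots> = (norm (grad f x))\<^sup>2 + 2 * b * w x * f x * (x \<bullet> grad f x) + b\<^sup>2 * (w x)\<^sup>2 * (norm x)\<^sup>2 * (f x)\<^sup>2"
      unfolding power2_norm_eq_inner
      by (simp add: inner_add_left inner_add_right inner_commute power2_eq_square algebra_simps)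
    finally have 1: "0 \<le> \<dots>" .
    have "(2 * b + b\<^sup>2) * ((w x)\<^sup>2 * (norm x)\<^sup>2) * (f x)\<^sup>2 \<le> (2 * b + b\<^sup>2) * w x * (f x)\<^sup>2"
      using b wn by (intro mult_right_mono mult_left_mono) auto
    moreover have "N = 2 * b + 2" by (simp add: b_def field_simps)
    ultimately show ?thesis using 1 unfolding S
      by (simp add: algebra_simps power2_eq_square)
  qed
  have "b\<^sup>2 * (\<integral>x. w x * (f x)\<^sup>2 \<partial>lborel) = (\<integral>x. b\<^sup>2 * (w x * (f x)\<^sup>2) \<partial>lborel)" by simp
  also have "\<dots> \<le> (\<integral>x. (norm (grad f x))\<^sup>2 + b * S x \<partial>lborel)"
    using wf iS Cc_inf_integrable_grad_sq[OF f] pw by (intro integral_mono) auto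
  also have "\<dots> = Dirichlet f"
    using iS Cc_inf_integrable_grad_sq[OF f] by (simp add: zS Dirichlet_def)
  finally have "b\<^sup>2 * (\<integral>x. w x * (f x)\<^sup>2 \<partial>lborel) \<le> Dirichlet f" .
  moreover have "(\<lambda>x. (f x)\<^sup>2 / ((norm x)\<^sup>2 + s)) = (\<lambda>x. w x * (f x)\<^sup>2)"
    by (auto simp: w_def divide_inverse)
  ultimately show ?thesis by (simp only: b_def N_def)
qed

text \<open>Fatou's lemma as the regularisation tends to 0. The nonnegative extended integral makes
  integrability part of the conclusion.\<close>

lemma Hardy:
  fixes f :: "real^'n \<Rightarrow> real"
  assumes f: "f \<in> Cc_inf" and N: "CARD('n) \<ge> 3"
  shows "(\<integral>\<^sup>+x. ennreal (1 / (norm x)\<^sup>2 * (f x)\<^sup>2) \<partial>lborel) \<le> ennreal (4 / (real CARD('n) - 2)\<^sup>2 * Dirichlet f)"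
proof -
  note [measurable] = Cc_inf_measurable[OF f]
  define s where "s n = inverse (real (Suc n))" for n
  have s: "s n > 0" for n by (simp add: s_def)
  define u where "u n x = ennreal ((f x)\<^sup>2 / ((norm x)\<^sup>2 + s n))" for n x
  let ?c = "4 / (real CARD('n) - 2)\<^sup>2 * Dirichlet f"
  have le: "(\<integral>\<^sup>+x. u n x \<partial>lborel) \<le> ennreal ?c" for n
  proof -
    have pos: "(norm x)\<^sup>2 + s n > 0" for x :: "real^'n" using s by (simp add: add_nonneg_pos)
    have "smooth_fun (\<lambda>x::real^'n. ((norm x)\<^sup>2 + s n) powr (-1))"
      using pos by (intro smooth_fun_intros smooth_fun_norm_sq)
    then have "integrable lborel (\<lambda>x. ((norm x)\<^sup>2 + s n) powr (-1) * (f x)\<^sup>2)"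
      by (intro Cc_inf_integrable Cc_inf_mult Cc_inf_square f)
    moreover have "((norm x)\<^sup>2 + s n) powr (-1) * (f x)\<^sup>2 = (f x)\<^sup>2 / ((norm x)\<^sup>2 + s n)" for x
      using pos[of x] by (simp add: powr_minus divide_inverse mult.commute abs_of_pos)
    ultimately have I: "integrable lborel (\<lambda>x. (f x)\<^sup>2 / ((norm x)\<^sup>2 + s n))" by (simp only:)
    have "(\<integral>\<^sup>+x. u n x \<partial>lborel) = ennreal (\<integral>x. (f x)\<^sup>2 / ((norm x)\<^sup>2 + s n) \<partial>lborel)"
      unfolding u_def using I less_imp_le[OF pos] by (intro nn_integral_eq_integral) auto
    also have "\<dots> \<le> ennreal ?c"
      using Hardy_regularized[OF f s N, of n] N by (intro ennreal_leI) (simp add: field_simps)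
    finally show ?thesis .
  qed
  have "(\<integral>\<^sup>+x. ennreal (1 / (norm x)\<^sup>2 * (f x)\<^sup>2) \<partial>lborel) \<le> (\<integral>\<^sup>+x. liminf (\<lambda>n. u n x) \<partial>lborel)"
  proof (rule nn_integral_mono)
    fix x :: "real^'n"
    show "ennreal (1 / (norm x)\<^sup>2 * (f x)\<^sup>2) \<le> liminf (\<lambda>n. u n x)"
    \<comment> \<open>At the origin the left side is 0, because \<open>1 / 0 = 0\<close>.\<close>
    proof (cases "x = 0")
      case False
      have "s \<longlonglongrightarrow> 0" unfolding s_def by (rule LIMSEQ_inverse_real_of_nat)
      then have "(\<lambda>n. (f x)\<^sup>2 / ((norm x)\<^sup>2 + s n)) \<longlonglongrightarrow> (f x)\<^sup>2 / ((norm x)\<^sup>2 + 0)"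
        using False by (intro tendsto_intros) auto
      then have "(\<lambda>n. u n x) \<longlonglongrightarrow> ennreal (1 / (norm x)\<^sup>2 * (f x)\<^sup>2)"
        unfolding u_def by (intro tendsto_ennrealI) simp
      then show ?thesis using lim_imp_Liminf[OF sequentially_bot] by force
    qed simp
  qed
  also have "\<dots> \<le> liminf (\<lambda>n. \<integral>\<^sup>+x. u n x \<partial>lborel)"
    by (rule nn_integral_liminf) (auto simp: u_def)
  also have "\<dots> \<le> liminf (\<lambda>n. ennreal ?c)"
    by (intro Liminf_mono always_eventually allI le)
  finally show ?thesis by (simp add: Liminf_const)
qed

section \<open>Form-bounded potentials\<close>

text \<open>The bound is on the extended integral of the absolute value: it then implies
  integrability, passes to potentials of smaller absolute value, and survives Fatou's lemma in the
  passage to the completion.\<close>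

definition form_bound :: "(real^'n \<Rightarrow> real) \<Rightarrow> real \<Rightarrow> bool" where
  "form_bound P c \<longleftrightarrow> P \<in> borel_measurable borel \<and> c \<ge> 0 \<and>
     (\<forall>f\<in>Cc_inf. (\<integral>\<^sup>+x. ennreal (\<bar>P x\<bar> * (f x)\<^sup>2) \<partial>lborel) \<le> ennreal (c * Dirichlet f))"

lemma form_bound_measurable: "form_bound P c \<Longrightarrow> P \<in> borel_measurable borel"
  by (simp add: form_bound_def)

lemma form_boundD:
  "form_bound P c \<Longrightarrow> f \<in> Cc_inf \<Longrightarrow> (\<integral>\<^sup>+x. ennreal (\<bar>P x\<bar> * (f x)\<^sup>2) \<partial>lborel) \<le> ennreal (c * Dirichlet f)"
  by (simp add: form_bound_def)

lemma form_bound_integrable: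
  assumes "form_bound P c" "f \<in> Cc_inf"
  shows "integrable lborel (\<lambda>x. P x * (f x)\<^sup>2)"
proof (rule integrableI_bounded)
  note [measurable] = form_bound_measurable[OF assms(1)] Cc_inf_measurable[OF assms(2)]
  show "(\<lambda>x. P x * (f x)\<^sup>2) \<in> borel_measurable lborel" by measurable
  have "(\<integral>\<^sup>+x. ennreal (norm (P x * (f x)\<^sup>2)) \<partial>lborel) \<le> ennreal (c * Dirichlet f)"
    using assms by (simp add: form_bound_def abs_mult)
  then show "(\<integral>\<^sup>+x. ennreal (norm (P x * (f x)\<^sup>2)) \<partial>lborel) < \<infinity>"
    by (simp add: le_less_trans[OF _ ennreal_less_top])
qed

lemma form_bound_abs_integral:
  assumes P: "form_bound P c" and f: "f \<in> Cc_inf"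
  shows "(\<integral>x. \<bar>P x\<bar> * (f x)\<^sup>2 \<partial>lborel) \<le> c * Dirichlet f"
proof -
  have "integrable lborel (\<lambda>x. \<bar>P x\<bar> * (f x)\<^sup>2)"
    using integrable_abs[OF form_bound_integrable[OF P f]] by (simp add: abs_mult)
  then have "ennreal (\<integral>x. \<bar>P x\<bar> * (f x)\<^sup>2 \<partial>lborel) \<le> ennreal (c * Dirichlet f)"
    using P f by (subst nn_integral_eq_integral[symmetric]) (auto simp: form_bound_def)
  moreover have "c * Dirichlet f \<ge> 0" using P by (simp add: form_bound_def Dirichlet_nonneg)
  ultimately show ?thesis by simp
qed

lemma form_bound_integral:
  assumes P: "form_bound P c" and f: "f \<in> Cc_inf"
  shows "\<bar>\<integral>x. P x * (f x)\<^sup>2 \<partial>lborel\<bar> \<le> c * Dirichlet f"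
proof -
  have "\<bar>\<integral>x. P x * (f x)\<^sup>2 \<partial>lborel\<bar> \<le> (\<integral>x. \<bar>P x * (f x)\<^sup>2\<bar> \<partial>lborel)" by (rule integral_abs_bound)
  also have "\<dots> \<le> c * Dirichlet f" using form_bound_abs_integral[OF P f] by (simp add: abs_mult)
  finally show ?thesis .
qed

lemma form_bound_mono:
  assumes "form_bound Q c" "P \<in> borel_measurable borel" "AE x in lborel. \<bar>P x\<bar> \<le> \<bar>Q x\<bar>" "c \<le> d"
  shows "form_bound P d"
  unfolding form_bound_def
proof (intro conjI ballI)
  fix f :: "real^'a \<Rightarrow> real" assume f: "f \<in> Cc_inf"
  have "(\<integral>\<^sup>+x. ennreal (\<bar>P x\<bar> * (f x)\<^sup>2) \<partial>lborel) \<le> (\<integral>\<^sup>+x. ennreal (\<bar>Q x\<bar> * (f x)\<^sup>2) \<partial>lborel)"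
    using assms(3) by (intro nn_integral_mono_AE) (auto elim!: eventually_mono intro!: ennreal_leI mult_right_mono)
  also have "\<dots> \<le> ennreal (c * Dirichlet f)" using assms(1) f by (simp add: form_bound_def)
  also have "\<dots> \<le> ennreal (d * Dirichlet f)"
    using assms(4) by (intro ennreal_leI mult_right_mono) (auto simp: Dirichlet_nonneg)
  finally show "(\<integral>\<^sup>+x. ennreal (\<bar>P x\<bar> * (f x)\<^sup>2) \<partial>lborel) \<le> ennreal (d * Dirichlet f)" .
qed (use assms in \<open>auto simp: form_bound_def\<close>)

lemma form_bound_add:
  assumes P: "form_bound P c" and Q: "form_bound Q d"
  shows "form_bound (\<lambda>x. P x + Q x) (c + d)"
  unfolding form_bound_def
proof (intro conjI ballI)
  note [measurable] = form_bound_measurable[OF P] form_bound_measurable[OF Q]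
  show "(\<lambda>x. P x + Q x) \<in> borel_measurable borel" by measurable
  fix f :: "real^'a \<Rightarrow> real" assume f: "f \<in> Cc_inf"
  note [measurable] = Cc_inf_measurable[OF f]
  have "(\<integral>\<^sup>+x. ennreal (\<bar>P x + Q x\<bar> * (f x)\<^sup>2) \<partial>lborel)
      \<le> (\<integral>\<^sup>+x. ennreal (\<bar>P x\<bar> * (f x)\<^sup>2) + ennreal (\<bar>Q x\<bar> * (f x)\<^sup>2) \<partial>lborel)"
    by (intro nn_integral_mono) (auto simp flip: ennreal_plus distrib_right intro!: ennreal_leI mult_right_mono)
  also have "\<dots> = (\<integral>\<^sup>+x. ennreal (\<bar>P x\<bar> * (f x)\<^sup>2) \<partial>lborel) + (\<integral>\<^sup>+x. ennreal (\<bar>Q x\<bar> * (f x)\<^sup>2) \<partial>lborel)"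
    by (intro nn_integral_add) measurable
  also have "\<dots> \<le> ennreal (c * Dirichlet f) + ennreal (d * Dirichlet f)"
    using P Q f by (intro add_mono) (auto simp: form_bound_def)
  also have "\<dots> = ennreal ((c + d) * Dirichlet f)"
    using P Q by (simp add: form_bound_def Dirichlet_nonneg distrib_right ennreal_plus)
  finally show "(\<integral>\<^sup>+x. ennreal (\<bar>P x + Q x\<bar> * (f x)\<^sup>2) \<partial>lborel) \<le> ennreal ((c + d) * Dirichlet f)" .
qed (use assms in \<open>auto simp: form_bound_def\<close>)

lemma form_bound_zero: "form_bound (\<lambda>x. 0) 0"
  by (simp add: form_bound_def)

lemma form_bound_sum:
  assumes "finite A" "\<And>i. i \<in> A \<Longrightarrow> form_bound (P i) (c i)"
  shows "form_bound (\<lambda>x. \<Sum>i\<in>A. P i x) (\<Sum>i\<in>A. c i)"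
  using assms by (induction A rule: finite_induct) (auto intro!: form_bound_zero form_bound_add)

lemma form_bound_scale:
  assumes P: "form_bound P c"
  shows "form_bound (\<lambda>x. a * P x) (\<bar>a\<bar> * c)"
  unfolding form_bound_def
proof (intro conjI ballI)
  note [measurable] = form_bound_measurable[OF P]
  show "(\<lambda>x. a * P x) \<in> borel_measurable borel" by measurable
  fix f :: "real^'a \<Rightarrow> real" assume f: "f \<in> Cc_inf"
  note [measurable] = Cc_inf_measurable[OF f]
  have "(\<integral>\<^sup>+x. ennreal (\<bar>a * P x\<bar> * (f x)\<^sup>2) \<partial>lborel) = ennreal \<bar>a\<bar> * (\<integral>\<^sup>+x. ennreal (\<bar>P x\<bar> * (f x)\<^sup>2) \<partial>lborel)"
    by (subst nn_integral_cmult[symmetric]) (auto intro!: nn_integral_cong simp: ennreal_mult'[symmetric] abs_mult mult.assoc)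
  also have "\<dots> \<le> ennreal \<bar>a\<bar> * ennreal (c * Dirichlet f)"
    using P f by (intro mult_left_mono) (auto simp: form_bound_def)
  finally show "(\<integral>\<^sup>+x. ennreal (\<bar>a * P x\<bar> * (f x)\<^sup>2) \<partial>lborel) \<le> ennreal (\<bar>a\<bar> * c * Dirichlet f)"
    by (simp add: ennreal_mult'[symmetric] mult.assoc)
qed (use assms in \<open>auto simp: form_bound_def\<close>)

lemma form_bound_shift:
  assumes P: "form_bound P c"
  shows "form_bound (\<lambda>x. P (x - y)) c"
  unfolding form_bound_def
proof (intro conjI ballI)
  note [measurable] = form_bound_measurable[OF P]
  show "(\<lambda>x. P (x - y)) \<in> borel_measurable borel" by measurable
  fix f :: "real^'a \<Rightarrow> real" assume f: "f \<in> Cc_inf"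
  note [measurable] = Cc_inf_measurable[OF f]
  have "(\<integral>\<^sup>+x. ennreal (\<bar>P (x - y)\<bar> * (f x)\<^sup>2) \<partial>lborel) = (\<integral>\<^sup>+x. ennreal (\<bar>P x\<bar> * (f (x + y))\<^sup>2) \<partial>lborel)"
    by (subst (1) lborel_distr_plus[of y, symmetric], subst nn_integral_distr) (auto simp: add.commute)
  also have "\<dots> \<le> ennreal (c * Dirichlet (\<lambda>x. f (x + y)))"
    using P Cc_inf_shift[OF f] by (auto simp: form_bound_def)
  finally show "(\<integral>\<^sup>+x. ennreal (\<bar>P (x - y)\<bar> * (f x)\<^sup>2) \<partial>lborel) \<le> ennreal (c * Dirichlet f)"
    by (simp add: Dirichlet_shift[OF f])
qed (use assms in \<open>auto simp: form_bound_def\<close>)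

lemma form_bound_Hardy:
  assumes "CARD('n) \<ge> 3"
  shows "form_bound (\<lambda>x::real^'n. 1 / (norm (x - a))\<^sup>2) (4 / (real CARD('n) - 2)\<^sup>2)"
proof -
  have "form_bound (\<lambda>x::real^'n. 1 / (norm x)\<^sup>2) (4 / (real CARD('n) - 2)\<^sup>2)"
    unfolding form_bound_def using Hardy[OF _ assms] by auto
  from form_bound_shift[OF this, of a] show ?thesis .
qed

section \<open>Potentials in L^(N/2) and behaviour at infinity\<close>

lemma form_bound_Sobolev:
  fixes W :: "real^'n \<Rightarrow> real"
  assumes "CARD('n) \<ge> 3" "W \<in> borel_measurable borel"
    and "integrable lborel (\<lambda>x. \<bar>W x\<bar> powr (real CARD('n) / 2))"
  shows "form_bound W ((2 * (real CARD('n) - 1) / (real CARD('n) - 2))\<^sup>2 *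
    (\<integral>x. \<bar>W x\<bar> powr (real CARD('n) / 2) \<partial>lborel) powr (2 / CARD('n)))"
  using Cc_inf_Sobolev_potential[OF _ assms] assms(2) by (simp add: form_bound_def)

text \<open>The L^(N/2) norm of the tail tends to 0 by dominated convergence, hence so does its
  Sobolev bound. The free threshold \<open>M0\<close> lets the cut be placed beyond all
  poles.\<close>

lemma form_bound_tail:
  fixes W :: "real^'n \<Rightarrow> real"
  assumes N: "CARD('n) \<ge> 3" and W[measurable]: "W \<in> borel_measurable borel"
    and I: "integrable lborel (\<lambda>x. \<bar>W x\<bar> powr (real CARD('n) / 2))" and e: "e > 0"
  obtains M where "M > M0" "form_bound (\<lambda>x. W x * indicator (- ball 0 M) x) e"
proof -
  define S where "S = (2 * (real CARD('n) - 1) / (real CARD('n) - 2))\<^sup>2"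
  define Wn where "Wn n x = W x * indicator (- ball 0 (real n)) x" for n x
  have [measurable]: "Wn n \<in> borel_measurable borel" for n unfolding Wn_def by measurable
  have In: "integrable lborel (\<lambda>x. \<bar>Wn n x\<bar> powr (real CARD('n) / 2))" for n
    by (rule Bochner_Integration.integrable_bound[OF I])
      (auto simp: Wn_def indicator_def)
  have "(\<lambda>n. \<integral>x. \<bar>Wn n x\<bar> powr (real CARD('n) / 2) \<partial>lborel) \<longlonglongrightarrow> (\<integral>x. 0 \<partial>(lborel::(real^'n) measure))"
  proof (rule integral_dominated_convergence[OF _ _ I])
    show "AE x in lborel. (\<lambda>n. \<bar>Wn n x\<bar> powr (real CARD('n) / 2)) \<longlonglongrightarrow> 0"
    proof (rule AE_I2)
      fix x :: "real^'n"
      obtain n0 where n0: "norm x < real n0" using reals_Archimedean2 by blast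
      have "\<forall>\<^sub>F n in sequentially. \<bar>Wn n x\<bar> powr (real CARD('n) / 2) = 0"
        by (rule eventually_mono[OF eventually_ge_at_top[of n0]]) (use n0 in \<open>auto simp: Wn_def indicator_def\<close>)
      then show "(\<lambda>n. \<bar>Wn n x\<bar> powr (real CARD('n) / 2)) \<longlonglongrightarrow> 0" by (rule tendsto_eventually)
    qed
    show "AE x in lborel. norm (\<bar>Wn n x\<bar> powr (real CARD('n) / 2)) \<le> \<bar>W x\<bar> powr (real CARD('n) / 2)" for n
      by (rule AE_I2) (auto simp: Wn_def indicator_def)
  qed auto
  then have "(\<lambda>n. S * (\<integral>x. \<bar>Wn n x\<bar> powr (real CARD('n) / 2) \<partial>lborel) powr (2 / CARD('n))) \<longlonglongrightarrow> S * 0 powr (2 / CARD('n))"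
    by (intro tendsto_intros tendsto_powr') (auto intro!: always_eventually)
  then have "\<forall>\<^sub>F n in sequentially. S * (\<integral>x. \<bar>Wn n x\<bar> powr (real CARD('n) / 2) \<partial>lborel) powr (2 / CARD('n)) < e"
    using e by (intro order_tendstoD(2)) auto
  then have "\<forall>\<^sub>F n in sequentially. real n > M0 \<and> S * (\<integral>x. \<bar>Wn n x\<bar> powr (real CARD('n) / 2) \<partial>lborel) powr (2 / CARD('n)) < e"
    using filterlim_real_sequentially[unfolded filterlim_at_top_dense, rule_format, of M0] by eventually_elim auto
  then obtain n where n: "real n > M0" "S * (\<integral>x. \<bar>Wn n x\<bar> powr (real CARD('n) / 2) \<partial>lborel) powr (2 / CARD('n)) < e"
    by (auto simp: eventually_sequentially)
  have "form_bound (Wn n) e"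
    by (rule form_bound_mono[OF form_bound_Sobolev[OF N _ In]]) (use n in \<open>auto simp: S_def\<close>)
  then show thesis using n(1) that[of "real n"] by (simp add: Wn_def[abs_def])
qed

text \<open>The only properties of the class of potentials that enter the localisation argument.\<close>

definition asymp_inverse_square :: "(real^'n \<Rightarrow> real) \<Rightarrow> real \<Rightarrow> bool" where
  "asymp_inverse_square V l \<longleftrightarrow> (\<exists>C. form_bound V C) \<and>
     (\<forall>e>0. \<exists>M>0. form_bound (\<lambda>x. (V x - l / (norm x)\<^sup>2) * indicator (- ball 0 M) x) e)"

lemma class_V_asymp_inverse_square:
  fixes a :: "nat \<Rightarrow> real^'n"
  assumes N: "CARD('n) \<ge> 3" and V: "class_V_params k a r lam laminf R W"
  shows "asymp_inverse_square (Vpot k a r lam laminf R W) laminf"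
proof -
  have Wm[measurable]: "W \<in> borel_measurable borel"
    and WI: "integrable lborel (\<lambda>x. \<bar>W x\<bar> powr (real CARD('n) / 2))"
    using V by (auto simp: class_V_params_def)
  let ?H = "4 / (real CARD('n) - 2)\<^sup>2"
  have mono: "form_bound (\<lambda>x. c * indicator A x / (norm (x - b))\<^sup>2) (\<bar>c\<bar> * ?H)"
    if [measurable]: "A \<in> sets borel" for c A and b :: "real^'n"
    by (rule form_bound_mono[OF form_bound_scale[OF form_bound_Hardy[OF N, of b], of c]])
      (auto simp: indicator_def)
  have "form_bound (\<lambda>x. (\<Sum>i<k. lam i * indicator (ball (a i) (r i)) x / (norm (x - a i))\<^sup>2)) (\<Sum>i<k. \<bar>lam i\<bar> * ?H)"
    by (intro form_bound_sum mono) auto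
  from form_bound_add[OF form_bound_add[OF this mono[of "UNIV - ball 0 R" laminf 0]] form_bound_Sobolev[OF N Wm WI]]
  have 1: "\<exists>C. form_bound (Vpot k a r lam laminf R W) C"
    unfolding Vpot_def[abs_def] by auto
  have "\<exists>M>0. form_bound (\<lambda>x. (Vpot k a r lam laminf R W x - laminf / (norm x)\<^sup>2) * indicator (- ball 0 M) x) e"
    if e: "e > 0" for e
  proof -
    \<comment> \<open>Beyond this radius no ball around a pole is met and the outer characteristic
      function equals 1, so only \<open>W\<close> is left after subtracting the inverse-square
      term.\<close>
    define M0 where "M0 = \<bar>R\<bar> + (\<Sum>i<k. norm (a i) + \<bar>r i\<bar>)"
    have M0: "M0 \<ge> 0" unfolding M0_def by (intro add_nonneg_nonneg sum_nonneg) auto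
    obtain M where M: "M > M0" "form_bound (\<lambda>x. W x * indicator (- ball 0 M) x) e"
      using form_bound_tail[OF N Wm WI e] by blast
    have eq: "(Vpot k a r lam laminf R W x - laminf / (norm x)\<^sup>2) * indicator (- ball 0 M) x
        = W x * indicator (- ball 0 M) x" for x
    proof (cases "norm x \<ge> M")
      case True
      have "x \<notin> ball (a i) (r i)" if i: "i < k" for i
      proof -
        have "norm (a i) + \<bar>r i\<bar> \<le> (\<Sum>i<k. norm (a i) + \<bar>r i\<bar>)"
          using i by (intro member_le_sum) auto
        then have "norm x \<ge> norm (a i) + \<bar>r i\<bar>" using M(1) True by (simp add: M0_def)
        then show ?thesis using norm_triangle_ineq2[of x "a i"] by (simp add: dist_norm norm_minus_commute)
      qed
      moreover have "norm x \<ge> R"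
        using M(1) True sum_nonneg[of "{..<k}" "\<lambda>i. norm (a i) + \<bar>r i\<bar>"] by (simp add: M0_def)
      ultimately show ?thesis by (simp add: Vpot_def)
    qed simp
    show ?thesis using M M0 by (intro exI[of _ M]) (simp only: eq, simp)
  qed
  with 1 show ?thesis by (simp add: asymp_inverse_square_def)
qed

lemma form_bound_abs: "form_bound P c \<Longrightarrow> form_bound (\<lambda>x. \<bar>P x\<bar>) c"
  by (simp add: form_bound_def borel_measurable_abs)

text \<open>The weight \<open>j\<close> need not vanish inside the ball: the whole remainder is form
  bounded by Hardy, so a factor \<open>\<eta>\<close> suffices there, and outside the ball the
  remainder is small already. \<open>M\<close> and \<open>\<eta>\<close> precede \<open>j\<close>,
  so the angle can be built from them.\<close>

lemma form_bound_remainder_inner_cutoff: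
  fixes V :: "real^'n \<Rightarrow> real"
  assumes N: "CARD('n) \<ge> 3" and V: "asymp_inverse_square V l" and e: "e > 0"
  obtains M \<eta> where "M > 0" "\<eta> > 0"
    "\<forall>j\<in>borel_measurable borel. (\<forall>x. 0 \<le> j x \<and> j x \<le> 1) \<longrightarrow> (\<forall>x. norm x < M \<longrightarrow> j x \<le> \<eta>)
      \<longrightarrow> form_bound (\<lambda>x. (V x - l / (norm x)\<^sup>2) * j x) e"
proof -
  obtain C where C: "form_bound V C" using V by (auto simp: asymp_inverse_square_def)
  define D where "D x = V x - l / (norm x)\<^sup>2" for x
  define C' where "C' = C + \<bar>-l\<bar> * (4 / (real CARD('n) - 2)\<^sup>2)"
  have D: "form_bound D C'"
    using form_bound_add[OF C form_bound_scale[OF form_bound_Hardy[OF N, of 0], of "-l"]]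
    by (simp add: D_def[abs_def] C'_def)
  note [measurable] = form_bound_measurable[OF D]
  have C': "C' \<ge> 0" using D by (simp add: form_bound_def)
  obtain M where M: "M > 0" "form_bound (\<lambda>x. D x * indicator (- ball 0 M) x) (e / 2)"
    using V e unfolding asymp_inverse_square_def D_def by (meson half_gt_zero)
  \<comment> \<open>Gives \<open>\<eta> * C' \<le> e / 2\<close>; the added 1 covers the case
    \<open>C' = 0\<close>.\<close>
  define \<eta> where "\<eta> = e / (2 * (C' + 1))"
  have \<eta>: "\<eta> > 0" using e C' by (simp add: \<eta>_def)
  show thesis
  proof (rule that[OF M(1) \<eta>], intro ballI impI)
    fix j :: "real^'n \<Rightarrow> real"
    assume [measurable]: "j \<in> borel_measurable borel"
      and "\<forall>x. 0 \<le> j x \<and> j x \<le> 1" and "\<forall>x. norm x < M \<longrightarrow> j x \<le> \<eta>"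
    then have j: "0 \<le> j x \<and> j x \<le> 1" "norm x < M \<Longrightarrow> j x \<le> \<eta>" for x by auto
    have le: "\<bar>D x * j x\<bar> \<le> \<eta> * \<bar>D x\<bar> + \<bar>D x * indicator (- ball 0 M) x\<bar>" for x
    proof (cases "norm x < M")
      case True
      then have "\<bar>D x\<bar> * j x \<le> \<bar>D x\<bar> * \<eta>" using j by (intro mult_left_mono) auto
      then show ?thesis using j[of x] True by (simp add: abs_mult mult.commute)
    next
      case False
      then have "\<bar>D x\<bar> * j x \<le> \<bar>D x\<bar> * 1" using j by (intro mult_left_mono) auto
      moreover have "\<eta> * \<bar>D x\<bar> \<ge> 0" using \<eta> by simp
      ultimately show ?thesis using j(1)[of x] False by (simp add: abs_mult)
    qed
    have "form_bound (\<lambda>x. \<eta> * \<bar>D x\<bar> + \<bar>D x * indicator (- ball 0 M) x\<bar>) (\<bar>\<eta>\<bar> * C' + e / 2)"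
      by (intro form_bound_add form_bound_scale form_bound_abs D M(2))
    then have "form_bound (\<lambda>x. D x * j x) e"
    proof (rule form_bound_mono)
      show "AE x in lborel. \<bar>D x * j x\<bar> \<le> \<bar>\<eta> * \<bar>D x\<bar> + \<bar>D x * indicator (- ball 0 M) x\<bar>\<bar>"
        using le by (intro AE_I2) (meson abs_ge_self order_trans)
      show "\<bar>\<eta>\<bar> * C' + e / 2 \<le> e" using \<eta> e C' by (simp add: \<eta>_def field_simps)
    qed simp
    then show "form_bound (\<lambda>x. (V x - l / (norm x)\<^sup>2) * j x) e" by (simp add: D_def)
  qed
qed

text \<open>Far from the origin \<open>j\<close> is small and multiplies a form-bounded potential.
  Near the origin the translated potential is seen far from its centre: its remainder is small, and
  its inverse-square term is bounded by a small constant, hence by a small multiple of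
  1/|x|^2.\<close>

lemma form_bound_shifted_outer_cutoff:
  fixes V :: "real^'n \<Rightarrow> real"
  assumes N: "CARD('n) \<ge> 3" and V: "asymp_inverse_square V l" and e: "e > 0"
    and jm[measurable]: "j \<in> borel_measurable borel" and j: "\<And>x. 0 \<le> j x \<and> j x \<le> 1"
    and j0: "\<forall>\<eta>>0. \<exists>M. \<forall>x. norm x \<ge> M \<longrightarrow> j x \<le> \<eta>"
  obtains Y where "\<forall>y. norm y \<ge> Y \<longrightarrow> form_bound (\<lambda>x. V (x - y) * j x) e"
proof -
  obtain C where C: "form_bound V C" using V by (auto simp: asymp_inverse_square_def)
  have C0: "C \<ge> 0" using C by (simp add: form_bound_def)
  note [measurable] = form_bound_measurable[OF C]
  define H where "H = 4 / (real CARD('n) - 2)\<^sup>2"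
  have H: "H \<ge> 0" by (simp add: H_def)
  define T where "T M x = (V x - l / (norm x)\<^sup>2) * indicator (- ball 0 M) x" for M x
  obtain M1 where M1: "M1 > 0" "form_bound (T M1) (e / 3)"
    using V e unfolding asymp_inverse_square_def T_def by (meson zero_less_divide_iff zero_less_numeral)
  define \<eta> where "\<eta> = e / (3 * (C + 1))"
  have \<eta>: "\<eta> > 0" using e C0 by (simp add: \<eta>_def)
  obtain M' where M': "\<And>x. norm x \<ge> M' \<Longrightarrow> j x \<le> \<eta>" using j0 \<eta> by blast
  define M where "M = max M' 1"
  have M: "M \<ge> 1" "\<And>x. norm x \<ge> M \<Longrightarrow> j x \<le> \<eta>" using M' by (auto simp: M_def)
  \<comment> \<open>Since \<open>L \<le> L^2\<close>, this makes \<open>B * H \<le> e / 3\<close>,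
    one of three equal shares of the error.\<close>
  define L where "L = 1 + 3 * \<bar>l\<bar> * M\<^sup>2 * H / e"
  have L: "L \<ge> 1" using H e by (simp add: L_def)
  \<comment> \<open>On the ball of radius \<open>M\<close>,
    \<open>|l| / L^2 = B / M^2 \<le> B / |x|^2\<close> away from the origin, which Hardy's
    inequality controls.\<close>
  define B where "B = \<bar>l\<bar> * M\<^sup>2 / L\<^sup>2"
  have B: "B \<ge> 0" by (simp add: B_def)
  have BH: "B * H \<le> e / 3"
  proof -
    have "3 * \<bar>l\<bar> * M\<^sup>2 * H / e \<le> L" by (simp add: L_def)
    also have "L \<le> L\<^sup>2" using L by (simp add: power2_eq_square)
    finally show ?thesis using e L by (simp add: B_def field_simps)
  qed
  show thesis
  \<comment> \<open>With this \<open>Y\<close>, \<open>|x| < M\<close> implies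
    \<open>|x - y| \<ge> M1 + L\<close>: beyond the cut of the remainder and at distance at least
    \<open>L\<close> from the centre \<open>y\<close>.\<close>
  proof (rule that[of "M + M1 + L"], intro allI impI)
    fix y :: "real^'n" assume y: "norm y \<ge> M + M1 + L"
    let ?Q = "\<lambda>x. (\<eta> * \<bar>V (x - y)\<bar> + \<bar>T M1 (x - y)\<bar>) + B * (1 / (norm (x - 0))\<^sup>2)"
    \<comment> \<open>The origin, where \<open>1 / 0 = 0\<close> spoils the comparison, is a null
      set.\<close>
    have le: "\<bar>V (x - y) * j x\<bar> \<le> ?Q x" if x: "x \<noteq> 0" for x
    proof (cases "norm x < M")
      case True
      have n: "norm (x - y) \<ge> M1 + L" using norm_triangle_ineq2[of y x] y True by (simp add: norm_minus_commute)
      then have "T M1 (x - y) = V (x - y) - l / (norm (x - y))\<^sup>2" using L by (simp add: T_def)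
      moreover have "\<bar>l\<bar> / (norm (x - y))\<^sup>2 \<le> B * (1 / (norm x)\<^sup>2)"
      proof -
        have "\<bar>l\<bar> / (norm (x - y))\<^sup>2 \<le> \<bar>l\<bar> / L\<^sup>2"
          using n L M1 by (intro divide_left_mono power_mono mult_pos_pos) (auto intro!: zero_less_power)
        also have "\<dots> = B * (1 / M\<^sup>2)" using M by (simp add: B_def)
        also have "\<dots> \<le> B * (1 / (norm x)\<^sup>2)"
          using x True B by (intro mult_left_mono divide_left_mono power_mono mult_pos_pos) (auto intro!: zero_less_power)
        finally show ?thesis .
      qed
      moreover have "\<bar>l / (norm (x - y))\<^sup>2\<bar> = \<bar>l\<bar> / (norm (x - y))\<^sup>2" by simp
      ultimately have "\<bar>V (x - y)\<bar> \<le> \<bar>T M1 (x - y)\<bar> + B * (1 / (norm x)\<^sup>2)" by linarith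
      moreover have "\<bar>V (x - y)\<bar> * j x \<le> \<bar>V (x - y)\<bar> * 1" using j by (intro mult_left_mono) auto
      moreover have "\<eta> * \<bar>V (x - y)\<bar> \<ge> 0" using \<eta> by simp
      ultimately show ?thesis using j[of x] by (simp add: abs_mult)
    next
      case False
      then have "\<bar>V (x - y)\<bar> * j x \<le> \<bar>V (x - y)\<bar> * \<eta>" using M by (intro mult_left_mono) auto
      moreover have "B * (1 / (norm (x - 0))\<^sup>2) \<ge> 0" using B by simp
      ultimately show ?thesis using j[of x] by (simp add: abs_mult mult.commute)
    qed
    have "form_bound ?Q ((\<bar>\<eta>\<bar> * C + e / 3) + \<bar>B\<bar> * H)"
      unfolding H_def
      by (intro form_bound_add form_bound_scale form_bound_Hardy N form_bound_abs
          form_bound_shift[OF C] form_bound_shift[OF M1(2)])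
    then show "form_bound (\<lambda>x. V (x - y) * j x) e"
    proof (rule form_bound_mono)
      show "AE x in lborel. \<bar>V (x - y) * j x\<bar> \<le> \<bar>?Q x\<bar>"
        using AE_lborel_singleton[of 0] by eventually_elim (use le in \<open>meson abs_ge_self order_trans\<close>)
      have "\<eta> * C \<le> e / 3" using e C0 by (simp add: \<eta>_def field_simps)
      then show "\<bar>\<eta>\<bar> * C + e / 3 + \<bar>B\<bar> * H \<le> e" using BH \<eta> B by simp
    qed measurable
  qed
qed

section \<open>Localisation\<close>

text \<open>This is the IMS localisation formula: the mixed terms in the two gradients cancel,
  leaving only \<open>|grad \<theta>|^2 * f^2\<close>, which the assumption on the gradient makes a
  Hardy term centred at \<open>a\<close>.\<close>

lemma Dirichlet_split:
  fixes f \<theta> :: "real^'n \<Rightarrow> real"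
  assumes N: "CARD('n) \<ge> 3" and f: "f \<in> Cc_inf" and t: "smooth_fun \<theta>" and s: "s \<ge> 0"
    and g: "\<And>x. (norm (grad \<theta> x))\<^sup>2 \<le> s / (norm (x - a))\<^sup>2"
  shows "(\<lambda>x. sin (\<theta> x) * f x) \<in> Cc_inf" "(\<lambda>x. cos (\<theta> x) * f x) \<in> Cc_inf"
    and "Dirichlet (\<lambda>x. sin (\<theta> x) * f x) + Dirichlet (\<lambda>x. cos (\<theta> x) * f x)
      \<le> (1 + s * (4 / (real CARD('n) - 2)\<^sup>2)) * Dirichlet f"
proof -
  let ?f1 = "\<lambda>x. sin (\<theta> x) * f x" and ?f2 = "\<lambda>x. cos (\<theta> x) * f x"
  show f1: "?f1 \<in> Cc_inf" and f2: "?f2 \<in> Cc_inf"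
    using f t by (auto intro!: Cc_inf_mult smooth_fun_intros)
  have fs: "GDERIV f x :> grad f x" for x using smooth_fun_GDERIV[OF Cc_infD[OF f]] .
  have ts: "GDERIV \<theta> x :> grad \<theta> x" for x using smooth_fun_GDERIV[OF t] .
  have g1: "grad ?f1 x = sin (\<theta> x) *\<^sub>R grad f x + f x *\<^sub>R (cos (\<theta> x) *\<^sub>R grad \<theta> x)" for x
    by (intro grad_eqI GDERIV_mult fs GDERIV_DERIV_compose[OF ts] DERIV_sin)
  have g2: "grad ?f2 x = cos (\<theta> x) *\<^sub>R grad f x + f x *\<^sub>R ((- sin (\<theta> x)) *\<^sub>R grad \<theta> x)" for x
    by (intro grad_eqI GDERIV_mult fs GDERIV_DERIV_compose[OF ts] DERIV_cos)
  have id: "(norm (grad ?f1 x))\<^sup>2 + (norm (grad ?f2 x))\<^sup>2 = (norm (grad f x))\<^sup>2 + (norm (grad \<theta> x))\<^sup>2 * (f x)\<^sup>2" for x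
  proof -
    define S where "S = sin (\<theta> x)" define K where "K = cos (\<theta> x)"
    define p where "p = grad f x \<bullet> grad f x" define q where "q = grad \<theta> x \<bullet> grad \<theta> x"
    define r where "r = grad f x \<bullet> grad \<theta> x"
    have SK: "S\<^sup>2 + K\<^sup>2 = 1" by (simp add: S_def K_def)
    have "(norm (grad ?f1 x))\<^sup>2 + (norm (grad ?f2 x))\<^sup>2
       = (S\<^sup>2 * p + 2 * S * K * f x * r + K\<^sup>2 * (f x)\<^sup>2 * q) + (K\<^sup>2 * p - 2 * S * K * f x * r + S\<^sup>2 * (f x)\<^sup>2 * q)"
      unfolding g1 g2 power2_norm_eq_inner S_def K_def p_def q_def r_def
      by (simp add: inner_add_left inner_add_right inner_commute power2_eq_square algebra_simps)
    also have "\<dots> = (S\<^sup>2 + K\<^sup>2) * p + (S\<^sup>2 + K\<^sup>2) * (f x)\<^sup>2 * q" by (simp add: algebra_simps)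
    finally show ?thesis unfolding SK by (simp add: p_def q_def power2_norm_eq_inner)
  qed
  let ?h = "\<lambda>x. s * (1 / (norm (x - a))\<^sup>2)"
  have hb: "form_bound ?h (\<bar>s\<bar> * (4 / (real CARD('n) - 2)\<^sup>2))"
    by (intro form_bound_scale form_bound_Hardy N)
  have hi: "integrable lborel (\<lambda>x. ?h x * (f x)\<^sup>2)" by (rule form_bound_integrable[OF hb f])
  have I: "integrable lborel (\<lambda>x. (norm (grad ?f1 x))\<^sup>2)" "integrable lborel (\<lambda>x. (norm (grad ?f2 x))\<^sup>2)"
    "integrable lborel (\<lambda>x. (norm (grad f x))\<^sup>2)"
    using f1 f2 f Cc_inf_integrable_grad_sq by blast+
  have "Dirichlet ?f1 + Dirichlet ?f2 = (\<integral>x. (norm (grad ?f1 x))\<^sup>2 + (norm (grad ?f2 x))\<^sup>2 \<partial>lborel)"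
    unfolding Dirichlet_def using I by simp
  also have "\<dots> \<le> (\<integral>x. (norm (grad f x))\<^sup>2 + ?h x * (f x)\<^sup>2 \<partial>lborel)"
  proof (rule integral_mono)
    show "(norm (grad ?f1 x))\<^sup>2 + (norm (grad ?f2 x))\<^sup>2 \<le> (norm (grad f x))\<^sup>2 + ?h x * (f x)\<^sup>2" for x
      unfolding id using mult_right_mono[OF g[of x], of "(f x)\<^sup>2"] by simp
  qed (use I hi in auto)
  also have "\<dots> = Dirichlet f + (\<integral>x. ?h x * (f x)\<^sup>2 \<partial>lborel)"
    unfolding Dirichlet_def using I hi by simp
  also have "(\<integral>x. ?h x * (f x)\<^sup>2 \<partial>lborel) \<le> s * (4 / (real CARD('n) - 2)\<^sup>2) * Dirichlet f"
    using form_bound_integral[OF hb f] s by simp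
  finally show "Dirichlet ?f1 + Dirichlet ?f2 \<le> (1 + s * (4 / (real CARD('n) - 2)\<^sup>2)) * Dirichlet f"
    by (simp add: distrib_right)
qed

text \<open>The angle \<open>(pi / 2) (1 + c |x|\<^sup>2) powr (- alpha)\<close> varies on a logarithmic scale, so the error of
  the splitting is absorbed by Hardy's inequality with a small factor for small \<open>alpha\<close>.\<close>

lemma slow_cutoff_angle:
  assumes s: "s > 0" and M: "M > 0" and \<eta>: "\<eta> > 0"
  obtains \<theta> :: "real^'n \<Rightarrow> real" where "smooth_fun \<theta>"
    "\<forall>x. (norm (grad \<theta> x))\<^sup>2 \<le> s / (norm x)\<^sup>2"
    "\<forall>x. norm x < M \<longrightarrow> (cos (\<theta> x))\<^sup>2 \<le> \<eta>"
    "\<forall>\<epsilon>>0. \<exists>L. \<forall>x. norm x \<ge> L \<longrightarrow> (sin (\<theta> x))\<^sup>2 \<le> \<epsilon>"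
proof -
  \<comment> \<open>The gradient of the angle turns out to be at most
    \<open>pi * \<alpha> / |x|\<close>.\<close>
  define \<alpha> where "\<alpha> = sqrt s / pi"
  have \<alpha>: "\<alpha> > 0" using s by (simp add: \<alpha>_def)
  \<comment> \<open>The cosine will be at most \<open>2 * d \<le> sqrt \<eta>\<close>; the cap
    \<open>1/2\<close> keeps \<open>1 - d\<close> positive.\<close>
  define d where "d = min (1/2) (sqrt \<eta> / 2)"
  have d: "0 < d" "d < 1" "4 * d\<^sup>2 \<le> \<eta>"
  proof -
    show "0 < d" "d < 1" using \<eta> by (auto simp: d_def)
    then have "d\<^sup>2 \<le> (sqrt \<eta> / 2)\<^sup>2" by (intro power_mono) (auto simp: d_def)
    then show "4 * d\<^sup>2 \<le> \<eta>" using \<eta> by (simp add: power_divide)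
  qed
  \<comment> \<open>Solves \<open>(1 + c * M^2) powr (-\<alpha>) = 1 - d\<close>, so the angle stays
    close to \<open>pi / 2\<close> on the whole ball of radius \<open>M\<close>.\<close>
  define c where "c = ((1 - d) powr (- 1 / \<alpha>) - 1) / M\<^sup>2"
  have c1: "1 + c * M\<^sup>2 = (1 - d) powr (- 1 / \<alpha>)" using M by (simp add: c_def)
  have "(1 - d) powr 0 < (1 - d) powr (- 1 / \<alpha>)"
    using d \<alpha> by (intro powr_less_mono') auto
  then have c: "c > 0" using M d by (simp add: c_def)
  define b where "b x = 1 + c * (norm x)\<^sup>2" for x :: "real^'n"
  have b: "b x \<ge> 1" for x using c by (simp add: b_def)
  then have b0: "b x > 0" for x by (meson less_le_trans zero_less_one)
  define q where "q x = b x powr (- \<alpha>)" for x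
  have q: "0 < q x" "q x \<le> 1" for x
    using b0[of x] b[of x] \<alpha> powr_mono2'[of "-\<alpha>" 1 "b x"] by (auto simp: q_def)
  define \<theta> where "\<theta> x = pi / 2 * q x" for x
  have sb: "smooth_fun b" unfolding b_def[abs_def] by (intro smooth_fun_intros smooth_fun_norm_sq)
  have st: "smooth_fun \<theta>" unfolding \<theta>_def[abs_def] q_def
    by (intro smooth_fun_intros sb b0)
  have gt: "grad \<theta> x = (pi / 2 * (- \<alpha> * b x powr (- \<alpha> - 1))) *\<^sub>R ((2 * c) *\<^sub>R x)" for x
  proof (rule grad_eqI)
    have "GDERIV b x :> (2 * c) *\<^sub>R x"
      unfolding gderiv_def b_def[abs_def] power2_norm_eq_inner
      by (auto intro!: derivative_eq_intros simp: inner_commute)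
    moreover have "DERIV (\<lambda>u. pi / 2 * u powr (- \<alpha>)) (b x) :> pi / 2 * (- \<alpha> * b x powr (- \<alpha> - 1))"
      using b0 by (intro DERIV_cmult has_real_derivative_powr)
    ultimately show "GDERIV \<theta> x :> (pi / 2 * (- \<alpha> * b x powr (- \<alpha> - 1))) *\<^sub>R ((2 * c) *\<^sub>R x)"
      unfolding \<theta>_def[abs_def] q_def by (rule GDERIV_DERIV_compose)
  qed
  have "(norm (grad \<theta> x))\<^sup>2 \<le> s / (norm x)\<^sup>2" for x
  proof (cases "x = 0")
    case False
    have "b x powr (- \<alpha> - 1) \<le> b x powr (-1)" using b \<alpha> by (intro powr_mono) auto
    also have "\<dots> = 1 / b x" using b0[of x] by (simp add: powr_minus divide_inverse)
    also have "\<dots> \<le> 1 / (c * (norm x)\<^sup>2)"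
      using False c by (intro divide_left_mono) (auto simp: b_def add_pos_nonneg)
    finally have *: "b x powr (- \<alpha> - 1) \<le> 1 / (c * (norm x)\<^sup>2)" .
    have "norm (grad \<theta> x) = pi * \<alpha> * c * norm x * b x powr (- \<alpha> - 1)"
      unfolding gt using \<alpha> c by (simp add: abs_mult)
    also have "\<dots> \<le> pi * \<alpha> * c * norm x * (1 / (c * (norm x)\<^sup>2))"
      using \<alpha> c by (intro mult_left_mono *) auto
    also have "\<dots> = sqrt s / norm x"
      using False c by (simp add: \<alpha>_def power2_eq_square)
    finally have "(norm (grad \<theta> x))\<^sup>2 \<le> (sqrt s / norm x)\<^sup>2" by (intro power_mono) auto
    then show ?thesis using s by (simp add: power_divide)
  qed (simp add: gt)
  moreover have "(cos (\<theta> x))\<^sup>2 \<le> \<eta>" if x: "norm x < M" for x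
  proof -
    have "(1 - d) = ((1 - d) powr (- 1 / \<alpha>)) powr (- \<alpha>)" using d \<alpha> by (simp add: powr_powr)
    also have "\<dots> \<le> q x"
      unfolding q_def c1[symmetric] using \<alpha> x c b0[of x]
      by (intro powr_mono2') (auto simp: b_def intro!: mult_left_mono power_mono)
    finally have qd: "1 - q x \<le> d" by simp
    have "cos (\<theta> x) = sin (pi / 2 * (1 - q x))"
      by (simp add: \<theta>_def sin_cos_eq right_diff_distrib)
    moreover have "\<bar>sin (pi / 2 * (1 - q x))\<bar> \<le> \<bar>pi / 2 * (1 - q x)\<bar>" by (rule abs_sin_x_le_abs_x)
    moreover have "\<bar>pi / 2 * (1 - q x)\<bar> \<le> 2 * d"
      using q[of x] qd pi_less_4 by (simp add: abs_mult) (intro mult_mono; simp)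
    ultimately have "\<bar>cos (\<theta> x)\<bar> \<le> 2 * d" by simp
    then have "(cos (\<theta> x))\<^sup>2 \<le> (2 * d)\<^sup>2" using abs_le_square_iff[of "cos (\<theta> x)" "2 * d"] d by simp
    then show ?thesis using d(3) by (simp add: power_mult_distrib)
  qed
  moreover have "\<exists>L. \<forall>x. norm x \<ge> L \<longrightarrow> (sin (\<theta> x))\<^sup>2 \<le> \<epsilon>" if e: "\<epsilon> > 0" for \<epsilon>
  proof (intro exI allI impI)
    define \<delta> where "\<delta> = sqrt \<epsilon> / 2"
    have \<delta>: "\<delta> > 0" using e by (simp add: \<delta>_def)
    \<comment> \<open>At this radius \<open>c * |x|^2\<close> alone reaches
      \<open>\<delta> powr (- 1 / \<alpha>)\<close>, so \<open>q x \<le> \<delta>\<close>; then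
      \<open>pi < 4\<close> bounds the angle by
      \<open>2 * \<delta> = sqrt \<epsilon>\<close>.\<close>
    fix x :: "real^'n" assume x: "norm x \<ge> sqrt (\<delta> powr (- 1 / \<alpha>) / c)"
    have "\<delta> powr (- 1 / \<alpha>) / c = (sqrt (\<delta> powr (- 1 / \<alpha>) / c))\<^sup>2" using c by simp
    also have "\<dots> \<le> (norm x)\<^sup>2" using x c by (intro power_mono) auto
    finally have "\<delta> powr (- 1 / \<alpha>) \<le> c * (norm x)\<^sup>2" using c by (simp add: field_simps)
    then have "\<delta> powr (- 1 / \<alpha>) \<le> b x" by (simp add: b_def)
    then have "q x \<le> (\<delta> powr (- 1 / \<alpha>)) powr (- \<alpha>)"
      unfolding q_def using \<alpha> \<delta> by (intro powr_mono2') auto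
    also have "\<dots> = \<delta>" using \<alpha> \<delta> by (simp add: powr_powr)
    finally have "\<bar>\<theta> x\<bar> \<le> 2 * \<delta>"
      using q[of x] pi_less_4 by (simp add: \<theta>_def abs_mult) (intro mult_mono; simp)
    then have "\<bar>sin (\<theta> x)\<bar> \<le> sqrt \<epsilon>" using abs_sin_x_le_abs_x[of "\<theta> x"] by (simp add: \<delta>_def)
    then have "(sin (\<theta> x))\<^sup>2 \<le> (sqrt \<epsilon>)\<^sup>2" using abs_le_square_iff[of "sin (\<theta> x)" "sqrt \<epsilon>"] e by simp
    then show "(sin (\<theta> x))\<^sup>2 \<le> \<epsilon>" using e by simp
  qed
  ultimately show thesis using that[of \<theta>] st by blast
qed

section \<open>From test functions to the completion\<close>

text \<open>Young's inequality for the cross term; \<open>t\<close> stays free so that it can tend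
  to 0 more slowly than the squared distance.\<close>

lemma weighted_square_diff_le:
  fixes a b :: "'a::real_normed_vector"
  assumes t: "t > 0"
  shows "\<bar>(norm a)\<^sup>2 - (norm b)\<^sup>2\<bar> \<le> (1 + 1 / t) * (norm (a - b))\<^sup>2 + t * (norm b)\<^sup>2"
proof -
  define d where "d = norm a - norm b"
  have d: "\<bar>d\<bar> \<le> norm (a - b)" unfolding d_def by (rule norm_triangle_ineq3)
  have "2 * \<bar>d\<bar> * norm b \<le> d\<^sup>2 / t + t * (norm b)\<^sup>2"
  proof -
    have "0 \<le> (\<bar>d\<bar> - t * norm b)\<^sup>2 / t" using t by simp
    also have "\<dots> = d\<^sup>2 / t - 2 * \<bar>d\<bar> * norm b + t * (norm b)\<^sup>2"
      using t by (simp add: power2_diff power_mult_distrib field_simps power2_eq_square[of t])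
    finally show ?thesis by simp
  qed
  moreover have "\<bar>(norm a)\<^sup>2 - (norm b)\<^sup>2\<bar> \<le> d\<^sup>2 + 2 * \<bar>d\<bar> * norm b"
  proof -
    have "(norm a)\<^sup>2 - (norm b)\<^sup>2 = d\<^sup>2 + 2 * d * norm b"
      by (simp add: d_def power2_eq_square algebra_simps)
    moreover have "\<bar>d\<^sup>2 + 2 * d * norm b\<bar> \<le> \<bar>d\<^sup>2\<bar> + \<bar>2 * d * norm b\<bar>" by (rule abs_triangle_ineq)
    ultimately show ?thesis by (simp add: abs_mult)
  qed
  moreover have "d\<^sup>2 \<le> (norm (a - b))\<^sup>2" using power_mono[OF d, of 2] by simp
  then have "(1 + 1 / t) * d\<^sup>2 \<le> (1 + 1 / t) * (norm (a - b))\<^sup>2" using t by (intro mult_left_mono) auto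
  ultimately show ?thesis by (simp add: distrib_right)
qed

text \<open>The weight may change sign, so convergence is measured with \<open>|P|\<close>. With
  \<open>P = 1\<close> it yields the Dirichlet integrals, with a potential as \<open>P\<close> the
  potential terms.\<close>

lemma weighted_L2_convergence:
  fixes X :: "nat \<Rightarrow> 'a \<Rightarrow> 'b::real_normed_vector"
  assumes X: "\<And>k. integrable M (\<lambda>x. P x * (norm (X k x))\<^sup>2)"
    and Y: "integrable M (\<lambda>x. P x * (norm (Y x))\<^sup>2)"
    and D: "\<And>k. integrable M (\<lambda>x. \<bar>P x\<bar> * (norm (X k x - Y x))\<^sup>2)"
    and lim: "(\<lambda>k. \<integral>x. \<bar>P x\<bar> * (norm (X k x - Y x))\<^sup>2 \<partial>M) \<longlonglongrightarrow> 0"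
  shows "(\<lambda>k. \<integral>x. P x * (norm (X k x))\<^sup>2 \<partial>M) \<longlonglongrightarrow> (\<integral>x. P x * (norm (Y x))\<^sup>2 \<partial>M)"
proof -
  define d where "d k = (\<integral>x. \<bar>P x\<bar> * (norm (X k x - Y x))\<^sup>2 \<partial>M)" for k
  define B where "B = (\<integral>x. \<bar>P x\<bar> * (norm (Y x))\<^sup>2 \<partial>M)"
  have d0: "d k \<ge> 0" for k by (simp add: d_def)
  have YI: "integrable M (\<lambda>x. \<bar>P x\<bar> * (norm (Y x))\<^sup>2)" using integrable_abs[OF Y] by (simp add: abs_mult)
  \<comment> \<open>This tends to 0 while \<open>d k / t k \<le> sqrt (d k)\<close> does too; the
    second summand keeps \<open>t k\<close> positive when \<open>d k = 0\<close>.\<close>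
  define t where "t k = sqrt (d k) + inverse (real (Suc k))" for k
  have t: "t k > 0" for k using d0[of k] by (simp add: t_def add_nonneg_pos)
  have dl: "d \<longlonglongrightarrow> 0" using lim by (simp add: d_def[abs_def])
  have bound: "\<bar>(\<integral>x. P x * (norm (X k x))\<^sup>2 \<partial>M) - (\<integral>x. P x * (norm (Y x))\<^sup>2 \<partial>M)\<bar> \<le> (d k + sqrt (d k)) + t k * B" for k
  proof -
    have "\<bar>(\<integral>x. P x * (norm (X k x))\<^sup>2 \<partial>M) - (\<integral>x. P x * (norm (Y x))\<^sup>2 \<partial>M)\<bar>
       = \<bar>\<integral>x. P x * (norm (X k x))\<^sup>2 - P x * (norm (Y x))\<^sup>2 \<partial>M\<bar>"
      using X Y by simp
    also have "\<dots> \<le> (\<integral>x. \<bar>P x * (norm (X k x))\<^sup>2 - P x * (norm (Y x))\<^sup>2\<bar> \<partial>M)" by (rule integral_abs_bound)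
    also have "\<dots> \<le> (\<integral>x. (1 + 1 / t k) * (\<bar>P x\<bar> * (norm (X k x - Y x))\<^sup>2) + t k * (\<bar>P x\<bar> * (norm (Y x))\<^sup>2) \<partial>M)"
    proof (rule integral_mono)
      fix x
      have "\<bar>P x * (norm (X k x))\<^sup>2 - P x * (norm (Y x))\<^sup>2\<bar> = \<bar>P x\<bar> * \<bar>(norm (X k x))\<^sup>2 - (norm (Y x))\<^sup>2\<bar>"
        by (simp add: abs_mult flip: right_diff_distrib)
      also have "\<dots> \<le> \<bar>P x\<bar> * ((1 + 1 / t k) * (norm (X k x - Y x))\<^sup>2 + t k * (norm (Y x))\<^sup>2)"
        by (intro mult_left_mono weighted_square_diff_le t) auto
      finally show "\<bar>P x * (norm (X k x))\<^sup>2 - P x * (norm (Y x))\<^sup>2\<bar>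
        \<le> (1 + 1 / t k) * (\<bar>P x\<bar> * (norm (X k x - Y x))\<^sup>2) + t k * (\<bar>P x\<bar> * (norm (Y x))\<^sup>2)"
        by (simp add: algebra_simps)
    qed (use X Y D YI in auto)
    also have "\<dots> = (1 + 1 / t k) * d k + t k * B"
      using D YI by (simp add: d_def B_def)
    also have "(1 + 1 / t k) * d k \<le> d k + sqrt (d k)"
    proof -
      have "d k = sqrt (d k) * sqrt (d k)" using d0[of k] by simp
      also have "\<dots> \<le> sqrt (d k) * t k" using d0[of k] by (intro mult_left_mono) (auto simp: t_def)
      finally have "d k / t k \<le> sqrt (d k)" using t[of k] by (simp add: field_simps)
      then show ?thesis by (simp add: distrib_right)
    qed
    finally show ?thesis by simp
  qed
  have "(\<lambda>k. (d k + sqrt (d k)) + t k * B) \<longlonglongrightarrow> (0 + sqrt 0) + (sqrt 0 + 0) * B"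
    unfolding t_def by (intro tendsto_intros dl LIMSEQ_inverse_real_of_nat)
  then have "(\<lambda>k. (d k + sqrt (d k)) + t k * B) \<longlonglongrightarrow> 0" by simp
  then have "(\<lambda>k. (\<integral>x. P x * (norm (X k x))\<^sup>2 \<partial>M) - (\<integral>x. P x * (norm (Y x))\<^sup>2 \<partial>M)) \<longlonglongrightarrow> 0"
    by (rule Lim_null_comparison[rotated]) (use bound in auto)
  then show ?thesis by (simp add: LIM_zero_iff)
qed

lemma norm_sum_sq_le: "(norm (a + b))\<^sup>2 \<le> 2 * (norm a)\<^sup>2 + 2 * (norm b)\<^sup>2" for a b :: "'a::real_normed_vector"
proof -
  have "(norm (a + b))\<^sup>2 \<le> (norm a + norm b)\<^sup>2" by (intro power_mono norm_triangle_ineq) auto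
  also have "\<dots> \<le> 2 * (norm a)\<^sup>2 + 2 * (norm b)\<^sup>2"
    using sum_squares_bound[of "norm a" "norm b"] by (simp add: power2_sum)
  finally show ?thesis .
qed

text \<open>One sequence serves all form-bounded potentials. The form bound applied to differences
  of test functions, with Fatou in one index, shows convergence in the space weighted by
  \<open>|P|\<close>.\<close>

lemma in_D12_approx:
  assumes "in_D12 u G"
  obtains \<phi> where "\<And>k. \<phi> k \<in> Cc_inf" "(\<lambda>k. Dirichlet (\<phi> k)) \<longlonglongrightarrow> (\<integral>x. (norm (G x))\<^sup>2 \<partial>lborel)"
    "\<And>P c. form_bound P c \<Longrightarrow> (\<lambda>x. P x * (u x)\<^sup>2) \<in> borel_measurable borel \<Longrightarrow>
      (\<lambda>k. \<integral>x. P x * (\<phi> k x)\<^sup>2 \<partial>lborel) \<longlonglongrightarrow> (\<integral>x. P x * (u x)\<^sup>2 \<partial>lborel)"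
proof -
  obtain \<phi> where Gm[measurable]: "G \<in> borel_measurable lborel" and GI: "integrable lborel (\<lambda>x. (norm (G x))\<^sup>2)"
    and \<phi>: "\<And>k. \<phi> k \<in> Cc_inf"
    and L: "(\<lambda>k. \<integral>x. (norm (grad (\<phi> k) x - G x))\<^sup>2 \<partial>lborel) \<longlonglongrightarrow> 0"
    and AE: "AE x in lborel. (\<lambda>k. \<phi> k x) \<longlonglongrightarrow> u x"
    using assms unfolding in_D12_def by blast
  note [measurable] = Cc_inf_measurable[OF \<phi>] grad_measurable[OF \<phi>]
  define d where "d k = (\<integral>x. (norm (grad (\<phi> k) x - G x))\<^sup>2 \<partial>lborel)" for k
  have dI: "integrable lborel (\<lambda>x. (norm (grad (\<phi> k) x - G x))\<^sup>2)" for k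
  proof (rule Bochner_Integration.integrable_bound)
    show "integrable lborel (\<lambda>x. 2 * (norm (grad (\<phi> k) x))\<^sup>2 + 2 * (norm (G x))\<^sup>2)"
      using GI Cc_inf_integrable_grad_sq[OF \<phi>] by simp
    show "AE x in lborel. norm ((norm (grad (\<phi> k) x - G x))\<^sup>2) \<le> norm (2 * (norm (grad (\<phi> k) x))\<^sup>2 + 2 * (norm (G x))\<^sup>2)"
      using norm_sum_sq_le[of "grad (\<phi> k) _" "- G _"] by (intro AE_I2) simp
  qed measurable
  have DL: "(\<lambda>k. Dirichlet (\<phi> k)) \<longlonglongrightarrow> (\<integral>x. (norm (G x))\<^sup>2 \<partial>lborel)"
    using weighted_L2_convergence[of lborel "\<lambda>x. 1" "\<lambda>k. grad (\<phi> k)" G] GI dI L Cc_inf_integrable_grad_sq[OF \<phi>]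
    by (simp add: Dirichlet_def)
  have D2: "Dirichlet (\<lambda>x. \<phi> k x - \<phi> m x) \<le> 2 * d k + 2 * d m" for k m
  proof -
    have "Dirichlet (\<lambda>x. \<phi> k x - \<phi> m x) = (\<integral>x. (norm (grad (\<phi> k) x - grad (\<phi> m) x))\<^sup>2 \<partial>lborel)"
      by (simp add: Dirichlet_def grad_diff \<phi>)
    also have "\<dots> \<le> (\<integral>x. 2 * (norm (grad (\<phi> k) x - G x))\<^sup>2 + 2 * (norm (grad (\<phi> m) x - G x))\<^sup>2 \<partial>lborel)"
    proof (rule integral_mono)
      show "integrable lborel (\<lambda>x. (norm (grad (\<phi> k) x - grad (\<phi> m) x))\<^sup>2)"
        using Cc_inf_integrable_grad_sq[OF Cc_inf_diff[OF \<phi> \<phi>]] by (simp add: grad_diff \<phi>)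
      show "(norm (grad (\<phi> k) x - grad (\<phi> m) x))\<^sup>2 \<le> 2 * (norm (grad (\<phi> k) x - G x))\<^sup>2 + 2 * (norm (grad (\<phi> m) x - G x))\<^sup>2" for x
        using norm_sum_sq_le[of "grad (\<phi> k) x - G x" "G x - grad (\<phi> m) x"] by (simp add: norm_minus_commute)
    qed (use dI in auto)
    also have "\<dots> = 2 * d k + 2 * d m" using dI by (simp add: d_def)
    finally show ?thesis .
  qed
  have d0: "d k \<ge> 0" for k by (simp add: d_def)
  have dlim: "d \<longlonglongrightarrow> 0" using L by (simp add: d_def[abs_def])
  \<comment> \<open>A Borel representative of \<open>u\<close>, which itself is determined only
    almost everywhere.\<close>
  define v where "v x = lim (\<lambda>k. \<phi> k x)" for x
  have [measurable]: "v \<in> borel_measurable borel" unfolding v_def by measurable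
  have vu: "AE x in lborel. v x = u x" using AE by eventually_elim (simp add: v_def limI)
  have vlim: "AE x in lborel. (\<lambda>k. \<phi> k x) \<longlonglongrightarrow> v x" using AE vu by eventually_elim simp
  have PL: "(\<lambda>k. \<integral>x. P x * (\<phi> k x)\<^sup>2 \<partial>lborel) \<longlonglongrightarrow> (\<integral>x. P x * (u x)\<^sup>2 \<partial>lborel)"
    if P: "form_bound P c" and um[measurable]: "(\<lambda>x. P x * (u x)\<^sup>2) \<in> borel_measurable borel" for P c
  proof -
    note [measurable] = form_bound_measurable[OF P]
    have c: "c \<ge> 0" using P by (simp add: form_bound_def)
    have F: "(\<integral>\<^sup>+x. ennreal (\<bar>P x\<bar> * (\<phi> k x - v x)\<^sup>2) \<partial>lborel) \<le> ennreal (c * (2 * d k))" for k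
    proof -
      have "(\<integral>\<^sup>+x. ennreal (\<bar>P x\<bar> * (\<phi> k x - v x)\<^sup>2) \<partial>lborel)
        \<le> (\<integral>\<^sup>+x. liminf (\<lambda>m. ennreal (\<bar>P x\<bar> * (\<phi> k x - \<phi> m x)\<^sup>2)) \<partial>lborel)"
      proof (rule nn_integral_mono_AE)
        show "AE x in lborel. ennreal (\<bar>P x\<bar> * (\<phi> k x - v x)\<^sup>2) \<le> liminf (\<lambda>m. ennreal (\<bar>P x\<bar> * (\<phi> k x - \<phi> m x)\<^sup>2))"
          using vlim
        proof eventually_elim
          case (elim x)
          then have "(\<lambda>m. ennreal (\<bar>P x\<bar> * (\<phi> k x - \<phi> m x)\<^sup>2)) \<longlonglongrightarrow> ennreal (\<bar>P x\<bar> * (\<phi> k x - v x)\<^sup>2)"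
            by (intro tendsto_ennrealI tendsto_intros)
          then show ?case using lim_imp_Liminf[OF sequentially_bot] by force
        qed
      qed
      also have "\<dots> \<le> liminf (\<lambda>m. \<integral>\<^sup>+x. ennreal (\<bar>P x\<bar> * (\<phi> k x - \<phi> m x)\<^sup>2) \<partial>lborel)"
        by (rule nn_integral_liminf) measurable
      also have "\<dots> \<le> liminf (\<lambda>m. ennreal (c * (2 * d k + 2 * d m)))"
      proof (intro Liminf_mono always_eventually allI)
        fix m
        have "(\<integral>\<^sup>+x. ennreal (\<bar>P x\<bar> * (\<phi> k x - \<phi> m x)\<^sup>2) \<partial>lborel) \<le> ennreal (c * Dirichlet (\<lambda>x. \<phi> k x - \<phi> m x))"
          using form_boundD[OF P Cc_inf_diff[OF \<phi> \<phi>, of k m]] .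
        also have "\<dots> \<le> ennreal (c * (2 * d k + 2 * d m))" using D2 c by (intro ennreal_leI mult_left_mono)
        finally show "(\<integral>\<^sup>+x. ennreal (\<bar>P x\<bar> * (\<phi> k x - \<phi> m x)\<^sup>2) \<partial>lborel) \<le> ennreal (c * (2 * d k + 2 * d m))" .
      qed
      also have "\<dots> = ennreal (c * (2 * d k + 2 * 0))"
        by (intro lim_imp_Liminf tendsto_ennrealI tendsto_intros dlim) simp
      finally show ?thesis by simp
    qed
    have wI: "integrable lborel (\<lambda>x. \<bar>P x\<bar> * (\<phi> k x - v x)\<^sup>2)" for k
      by (rule integrableI_bounded) (use le_less_trans[OF F ennreal_less_top] in \<open>auto simp: abs_mult\<close>)
    have wle: "(\<integral>x. \<bar>P x\<bar> * (\<phi> k x - v x)\<^sup>2 \<partial>lborel) \<le> c * (2 * d k)" for k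
    proof -
      have "ennreal (\<integral>x. \<bar>P x\<bar> * (\<phi> k x - v x)\<^sup>2 \<partial>lborel) \<le> ennreal (c * (2 * d k))"
        using F[of k] nn_integral_eq_integral[OF wI[of k]] by simp
      then show ?thesis using c d0[of k] by simp
    qed
    have phiI: "integrable lborel (\<lambda>x. P x * (\<phi> k x)\<^sup>2)" for k by (rule form_bound_integrable[OF P \<phi>])
    have vI: "integrable lborel (\<lambda>x. P x * (v x)\<^sup>2)"
    proof (rule Bochner_Integration.integrable_bound)
      show "integrable lborel (\<lambda>x. 2 * \<bar>P x * (\<phi> 0 x)\<^sup>2\<bar> + 2 * (\<bar>P x\<bar> * (\<phi> 0 x - v x)\<^sup>2))"
        using wI[of 0] integrable_abs[OF phiI[of 0]] by simp
      show "AE x in lborel. norm (P x * (v x)\<^sup>2) \<le> norm (2 * \<bar>P x * (\<phi> 0 x)\<^sup>2\<bar> + 2 * (\<bar>P x\<bar> * (\<phi> 0 x - v x)\<^sup>2))"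
      proof (rule AE_I2)
        fix x
        have "(v x)\<^sup>2 \<le> 2 * (\<phi> 0 x)\<^sup>2 + 2 * (\<phi> 0 x - v x)\<^sup>2"
          using norm_sum_sq_le[of "\<phi> 0 x" "v x - \<phi> 0 x"] by (simp add: power2_commute)
        then have "\<bar>P x\<bar> * (v x)\<^sup>2 \<le> \<bar>P x\<bar> * (2 * (\<phi> 0 x)\<^sup>2 + 2 * (\<phi> 0 x - v x)\<^sup>2)" by (intro mult_left_mono) auto
        then show "norm (P x * (v x)\<^sup>2) \<le> norm (2 * \<bar>P x * (\<phi> 0 x)\<^sup>2\<bar> + 2 * (\<bar>P x\<bar> * (\<phi> 0 x - v x)\<^sup>2))"
          by (simp add: abs_mult algebra_simps)
      qed
    qed measurable
    have "(\<lambda>k. c * (2 * d k)) \<longlonglongrightarrow> c * (2 * 0)" by (intro tendsto_intros dlim)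
    then have "(\<lambda>k. c * (2 * d k)) \<longlonglongrightarrow> 0" by simp
    then have "(\<lambda>k. \<integral>x. \<bar>P x\<bar> * (\<phi> k x - v x)\<^sup>2 \<partial>lborel) \<longlonglongrightarrow> 0"
      by (rule Lim_null_comparison[rotated]) (use wle in auto)
    then have "(\<lambda>k. \<integral>x. P x * (\<phi> k x)\<^sup>2 \<partial>lborel) \<longlonglongrightarrow> (\<integral>x. P x * (v x)\<^sup>2 \<partial>lborel)"
      using weighted_L2_convergence[of lborel P \<phi> v] phiI vI wI by simp
    also have "(\<integral>x. P x * (v x)\<^sup>2 \<partial>lborel) = (\<integral>x. P x * (u x)\<^sup>2 \<partial>lborel)"
      by (intro integral_cong_AE) (use vu in \<open>auto elim: eventually_mono\<close>)
    finally show ?thesis .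
  qed
  show thesis by (rule that[OF \<phi> DL PL])
qed

text \<open>A function that is only almost everywhere equal to a Borel function may make the integrand
  non-measurable; its Bochner integral over \<open>lborel\<close> is then \<open>0\<close>.\<close>

lemma form_le_D12:
  fixes P :: "real^'n \<Rightarrow> real"
  assumes P: "form_bound P c" and b: "b \<ge> 0"
    and le: "\<And>f. f \<in> Cc_inf \<Longrightarrow> (\<integral>x. P x * (f x)\<^sup>2 \<partial>lborel) \<le> b * Dirichlet f"
    and u: "in_D12 u G"
  shows "(\<integral>x. P x * (u x)\<^sup>2 \<partial>lborel) \<le> b * (\<integral>x. (norm (G x))\<^sup>2 \<partial>lborel)"
proof (cases "(\<lambda>x. P x * (u x)\<^sup>2) \<in> borel_measurable borel")
  case True
  show ?thesis
  proof (rule in_D12_approx[OF u])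
    fix \<phi> :: "nat \<Rightarrow> real^'n \<Rightarrow> real"
    assume \<phi>: "\<And>k. \<phi> k \<in> Cc_inf"
      and D: "(\<lambda>k. Dirichlet (\<phi> k)) \<longlonglongrightarrow> (\<integral>x. (norm (G x))\<^sup>2 \<partial>lborel)"
      and L: "\<And>P c. form_bound P c \<Longrightarrow> (\<lambda>x. P x * (u x)\<^sup>2) \<in> borel_measurable borel \<Longrightarrow>
        (\<lambda>k. \<integral>x. P x * (\<phi> k x)\<^sup>2 \<partial>lborel) \<longlonglongrightarrow> (\<integral>x. P x * (u x)\<^sup>2 \<partial>lborel)"
    show ?thesis
      by (rule LIMSEQ_le[OF L[OF P True] tendsto_mult_left[OF D]]) (use le \<phi> in auto)
  qed
next
  case False
  then have "\<not> integrable lborel (\<lambda>x. P x * (u x)\<^sup>2)"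
    using borel_measurable_integrable by force
  then show ?thesis using b by (simp add: not_integrable_integral_eq)
qed

section \<open>The constant mu on test functions\<close>

lemma Cc_inf_in_D12:
  assumes "f \<in> Cc_inf" shows "in_D12 f (grad f)"
  unfolding in_D12_def
  using assms grad_measurable[OF assms] Cc_inf_integrable_grad_sq[OF assms]
  by (auto intro!: exI[of _ "\<lambda>k. f"])

lemma mu_pos_form_le:
  fixes V :: "real^'n \<Rightarrow> real"
  assumes V: "form_bound V C" and mu: "mu V > 0"
  obtains m where "0 < m" "m \<le> 1" "\<forall>f\<in>Cc_inf. (\<integral>x. V x * (f x)\<^sup>2 \<partial>lborel) \<le> (1 - m) * Dirichlet f"
proof -
  define S where "S = {(integral\<^sup>L lborel (\<lambda>x. (norm (G x))\<^sup>2) - integral\<^sup>L lborel (\<lambda>x. V x * (u x)\<^sup>2))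
                 / integral\<^sup>L lborel (\<lambda>x. (norm (G x))\<^sup>2)
              | u G. in_D12 u G \<and> \<not> (AE x in lborel. u x = 0)}"
  have muS: "mu V = Inf S" by (simp add: mu_def S_def)
  have C: "C \<ge> 0" using V by (simp add: form_bound_def)
  \<comment> \<open>An infimum of reals is a lower bound only for a set bounded below; here the form
    bound of \<open>V\<close> provides the bound \<open>-C\<close>. A vanishing denominator gives
    the quotient 0.\<close>
  have bdd: "bdd_below S"
  proof (rule bdd_belowI)
    fix z assume "z \<in> S"
    then obtain u G where uG: "in_D12 u G"
      and z: "z = ((\<integral>x. (norm (G x))\<^sup>2 \<partial>lborel) - (\<integral>x. V x * (u x)\<^sup>2 \<partial>lborel)) / (\<integral>x. (norm (G x))\<^sup>2 \<partial>lborel)"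
      by (auto simp: S_def)
    define A where "A = (\<integral>x. (norm (G x))\<^sup>2 \<partial>lborel)"
    have A: "A \<ge> 0" by (simp add: A_def)
    have "(\<integral>x. V x * (u x)\<^sup>2 \<partial>lborel) \<le> C * A"
      unfolding A_def by (rule form_le_D12[OF V C _ uG]) (use form_bound_integral[OF V] in \<open>fastforce simp: abs_le_iff\<close>)
    then show "- C \<le> z"
      using A C unfolding z A_def[symmetric] by (cases "A = 0") (auto simp: field_simps)
  qed
  \<comment> \<open>The cap at 1 keeps \<open>1 - m\<close> nonnegative.\<close>
  define m where "m = min (mu V) 1"
  show thesis
  proof (rule that[of m]; (intro ballI)?)
    show "0 < m" "m \<le> 1" using mu by (auto simp: m_def)
    fix f :: "real^'n \<Rightarrow> real" assume f: "f \<in> Cc_inf"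
    note [measurable] = Cc_inf_measurable[OF f] form_bound_measurable[OF V]
    have D0: "Dirichlet f \<ge> 0" by (rule Dirichlet_nonneg)
    \<comment> \<open>Functions vanishing almost everywhere are excluded from the infimum, and a
      zero Dirichlet integral makes the quotient uninformative; both cases are settled
      directly.\<close>
    consider (zero) "AE x in lborel. f x = 0" | (flat) "Dirichlet f = 0" | (pos) "\<not> (AE x in lborel. f x = 0)" "Dirichlet f > 0"
      using D0 by fastforce
    then show "(\<integral>x. V x * (f x)\<^sup>2 \<partial>lborel) \<le> (1 - m) * Dirichlet f"
    proof cases
      case zero
      then have "(\<integral>x. V x * (f x)\<^sup>2 \<partial>lborel) = (\<integral>x. 0 \<partial>(lborel :: (real^'n) measure))"
        by (intro integral_cong_AE) (auto elim: eventually_mono)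
      then show ?thesis using D0 by (simp add: m_def)
    next
      case flat
      then show ?thesis using form_bound_integral[OF V f] by simp
    next
      case pos
      have "(Dirichlet f - (\<integral>x. V x * (f x)\<^sup>2 \<partial>lborel)) / Dirichlet f \<in> S"
        unfolding S_def Dirichlet_def using Cc_inf_in_D12[OF f] pos(1) by blast
      then have "mu V \<le> (Dirichlet f - (\<integral>x. V x * (f x)\<^sup>2 \<partial>lborel)) / Dirichlet f"
        unfolding muS using bdd by (rule cInf_lower)
      then have "m \<le> (Dirichlet f - (\<integral>x. V x * (f x)\<^sup>2 \<partial>lborel)) / Dirichlet f" by (simp add: m_def)
      then show ?thesis using pos(2) by (simp add: field_simps)
    qed
  qed
qed

section \<open>Two distant potentials\<close>

text \<open>Both \<open>Y\<close> and \<open>\<epsilon>\<close> precede \<open>y\<close>, so the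
  bound is uniform over all large translations.\<close>

lemma two_potentials_form_le:
  fixes V1 V2 :: "real^'n \<Rightarrow> real"
  assumes N: "CARD('n) \<ge> 3"
    and V1: "asymp_inverse_square V1 l1" and V2: "asymp_inverse_square V2 l2"
    and mu1: "mu V1 > 0" and mu2: "mu V2 > 0"
    and l: "l1 < ((real CARD('n) - 2) / 2)\<^sup>2" "l2 < ((real CARD('n) - 2) / 2)\<^sup>2"
      "l1 + l2 < ((real CARD('n) - 2) / 2)\<^sup>2"
  obtains Y \<epsilon> where "0 < \<epsilon>" "\<epsilon> \<le> 1"
    "\<forall>y. \<forall>f\<in>Cc_inf. norm y \<ge> Y \<longrightarrow> (\<integral>x. (V1 x + V2 (x - y)) * (f x)\<^sup>2 \<partial>lborel) \<le> (1 - \<epsilon>) * Dirichlet f"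
proof -
  define H where "H = 4 / (real CARD('n) - 2)\<^sup>2"
  have H: "H > 0" using N by (simp add: H_def)
  have Hinv: "H * ((real CARD('n) - 2) / 2)\<^sup>2 = 1" using N by (simp add: H_def power_divide)
  \<comment> \<open>Hardy bounds an inverse-square term from above only for a nonnegative
    coefficient; a negative one is dropped. The sum \<open>p1 + p2\<close> is 0, \<open>l1\<close>,
    \<open>l2\<close> or \<open>l1 + l2\<close>, which is why all three upper bounds enter.\<close>
  define p1 where "p1 = max l1 0" define p2 where "p2 = max l2 0"
  have "p1 + p2 < ((real CARD('n) - 2) / 2)\<^sup>2"
    using l N by (auto simp: p1_def p2_def max_def)
  then have \<kappa>: "H * (p1 + p2) < 1" using mult_strict_left_mono[OF _ H] Hinv by metis
  obtain C1 C2 where C1: "form_bound V1 C1" and C2: "form_bound V2 C2"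
    using V1 V2 by (auto simp: asymp_inverse_square_def)
  note [measurable] = form_bound_measurable[OF C1] form_bound_measurable[OF C2]
  obtain m1 where m1: "0 < m1" "m1 \<le> 1"
    "\<forall>f\<in>Cc_inf. (\<integral>x. V1 x * (f x)\<^sup>2 \<partial>lborel) \<le> (1 - m1) * Dirichlet f"
    using mu_pos_form_le[OF C1 mu1] by blast
  obtain m2 where m2: "0 < m2" "m2 \<le> 1"
    "\<forall>f\<in>Cc_inf. (\<integral>x. V2 x * (f x)\<^sup>2 \<partial>lborel) \<le> (1 - m2) * Dirichlet f"
    using mu_pos_form_le[OF C2 mu2] by blast
  \<comment> \<open>A gap to 1 common to the three pieces of the function.\<close>
  define \<delta> where "\<delta> = min (min m1 m2) (1 - H * (p1 + p2))"
  have \<delta>: "0 < \<delta>" "\<delta> \<le> m1" "\<delta> \<le> m2" "\<delta> \<le> 1 - H * (p1 + p2)" "\<delta> \<le> 1"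
    using m1 m2 \<kappa> by (auto simp: \<delta>_def)
  \<comment> \<open>The errors add up to \<open>8 * e = \<delta> / 2\<close>.\<close>
  define e where "e = \<delta> / 16"
  have e: "0 < e" "e \<le> 1" using \<delta> by (auto simp: e_def)
  define s where "s = e / H"
  have s: "s > 0" "s * H = e" using e H by (auto simp: s_def)
  obtain M1 \<eta>1 where M1: "M1 > 0" "\<eta>1 > 0"
    and B1: "\<forall>j\<in>borel_measurable borel. (\<forall>x. 0 \<le> j x \<and> j x \<le> 1) \<longrightarrow> (\<forall>x. norm x < M1 \<longrightarrow> j x \<le> \<eta>1)
      \<longrightarrow> form_bound (\<lambda>x. (V1 x - l1 / (norm x)\<^sup>2) * j x) e"
    using form_bound_remainder_inner_cutoff[OF N V1 e(1)] by blast
  obtain M2 \<eta>2 where M2: "M2 > 0" "\<eta>2 > 0"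
    and B2: "\<forall>j\<in>borel_measurable borel. (\<forall>x. 0 \<le> j x \<and> j x \<le> 1) \<longrightarrow> (\<forall>x. norm x < M2 \<longrightarrow> j x \<le> \<eta>2)
      \<longrightarrow> form_bound (\<lambda>x. (V2 x - l2 / (norm x)\<^sup>2) * j x) e"
    using form_bound_remainder_inner_cutoff[OF N V2 e(1)] by blast
  \<comment> \<open>One angle has to serve both centres.\<close>
  define M where "M = max M1 M2" define \<eta> where "\<eta> = min \<eta>1 \<eta>2"
  have M: "M > 0" "\<eta> > 0" using M1 M2 by (auto simp: M_def \<eta>_def)
  obtain \<theta> :: "real^'n \<Rightarrow> real" where t: "smooth_fun \<theta>" "\<forall>x. (norm (grad \<theta> x))\<^sup>2 \<le> s / (norm x)\<^sup>2"
    and tc: "\<forall>x. norm x < M \<longrightarrow> (cos (\<theta> x))\<^sup>2 \<le> \<eta>"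
    and ts: "\<forall>\<epsilon>>0. \<exists>L. \<forall>x. norm x \<ge> L \<longrightarrow> (sin (\<theta> x))\<^sup>2 \<le> \<epsilon>"
    using slow_cutoff_angle[OF s(1) M] by blast
  have [measurable]: "\<theta> \<in> borel_measurable borel"
    using t(1) by (intro borel_measurable_continuous_onI smooth_fun_continuous)
  have j: "(\<lambda>x. (sin (\<theta> x))\<^sup>2) \<in> borel_measurable borel" by measurable
  have j01: "0 \<le> (sin a)\<^sup>2 \<and> (sin a)\<^sup>2 \<le> 1" "0 \<le> (cos a)\<^sup>2 \<and> (cos a)\<^sup>2 \<le> 1" for a :: real
    using sin_cos_squared_add[of a] by (auto intro: order_trans[OF _ eq_refl] simp: abs_square_le_1)
  obtain Y1 where Y1: "\<forall>y. norm y \<ge> Y1 \<longrightarrow> form_bound (\<lambda>x. V2 (x - y) * (sin (\<theta> x))\<^sup>2) e"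
    using form_bound_shifted_outer_cutoff[OF N V2 e(1) j j01(1) ts] by blast
  obtain Y2 where Y2: "\<forall>y. norm y \<ge> Y2 \<longrightarrow> form_bound (\<lambda>x. V1 (x - y) * (sin (\<theta> x))\<^sup>2) e"
    using form_bound_shifted_outer_cutoff[OF N V1 e(1) j j01(1) ts] by blast
  show thesis
  proof (rule that[of "\<delta> / 2" "max Y1 Y2"]; (intro allI ballI impI)?)
    show "0 < \<delta> / 2" "\<delta> / 2 \<le> 1" using \<delta> by auto
    fix y :: "real^'n" and f :: "real^'n \<Rightarrow> real"
    assume f: "f \<in> Cc_inf" and y: "norm y \<ge> max Y1 Y2"
    define \<theta>' where "\<theta>' x = \<theta> (x - y)" for x
    have [measurable]: "\<theta>' \<in> borel_measurable borel" unfolding \<theta>'_def by measurable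
    have t': "smooth_fun \<theta>'"
      using smooth_fun_intros(5)[OF t(1), of "-y"] by (simp add: \<theta>'_def[abs_def])
    have gt': "(norm (grad \<theta>' x))\<^sup>2 \<le> s / (norm (x - y))\<^sup>2" for x
    proof -
      have "GDERIV (\<lambda>x. \<theta> (x + (- y))) x :> grad \<theta> (x + (- y))"
        by (intro GDERIV_shift smooth_fun_GDERIV t)
      then have "grad \<theta>' x = grad \<theta> (x - y)" by (intro grad_eqI) (simp add: \<theta>'_def[abs_def])
      then show ?thesis using t(2) by simp
    qed
    define f1 where "f1 x = sin (\<theta> x) * f x" for x
    define g where "g x = cos (\<theta> x) * f x" for x
    define f2 where "f2 x = sin (\<theta>' x) * g x" for x
    define f3 where "f3 x = cos (\<theta>' x) * g x" for x
    have f1: "f1 \<in> Cc_inf" and g: "g \<in> Cc_inf" and D1: "Dirichlet f1 + Dirichlet g \<le> (1 + e) * Dirichlet f"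
      using Dirichlet_split[OF N f t(1), of s 0] t(2) s unfolding f1_def[abs_def] g_def[abs_def] H_def by auto
    have f2: "f2 \<in> Cc_inf" and f3: "f3 \<in> Cc_inf" and D2: "Dirichlet f2 + Dirichlet f3 \<le> (1 + e) * Dirichlet g"
      using Dirichlet_split[OF N g t', of s y] gt' s unfolding f2_def[abs_def] f3_def[abs_def] H_def by auto
    define V where "V x = V1 x + V2 (x - y)" for x
    have C2y: "form_bound (\<lambda>x. V2 (x - y)) C2" by (rule form_bound_shift[OF C2])
    note I1 = form_bound_integrable[OF C1] and I2 = form_bound_integrable[OF C2y]
    note n = Dirichlet_nonneg
    have split: "(f x)\<^sup>2 = (f1 x)\<^sup>2 + (f2 x)\<^sup>2 + (f3 x)\<^sup>2" for x
    proof -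
      have "(f1 x)\<^sup>2 + (f2 x)\<^sup>2 + (f3 x)\<^sup>2 = ((sin (\<theta> x))\<^sup>2 + (cos (\<theta> x))\<^sup>2 * ((sin (\<theta>' x))\<^sup>2 + (cos (\<theta>' x))\<^sup>2)) * (f x)\<^sup>2"
        unfolding f1_def f2_def f3_def g_def by (simp only: power_mult_distrib distrib_left distrib_right mult_ac add_ac)
      then show ?thesis by simp
    qed
    have a1: "(\<integral>x. V1 x * (f1 x)\<^sup>2 \<partial>lborel) \<le> (1 - m1) * Dirichlet f1" using m1(3) f1 by blast
    \<comment> \<open>The squared cutoff is counted with the potential, so the estimate is in terms
      of \<open>f\<close> itself.\<close>
    have a2: "(\<integral>x. V2 (x - y) * (f1 x)\<^sup>2 \<partial>lborel) \<le> e * Dirichlet f"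
      using form_bound_integral[OF Y1[rule_format, of y] f] y by (simp add: f1_def power_mult_distrib mult.assoc)
    have a3: "(\<integral>x. V2 (x - y) * (f2 x)\<^sup>2 \<partial>lborel) \<le> (1 - m2) * Dirichlet f2"
      using integral_shift[of "\<lambda>x. V2 (x - y) * (f2 x)\<^sup>2" y] bspec[OF m2(3) Cc_inf_shift[OF f2, of y]]
      by (simp add: Dirichlet_shift[OF f2])
    \<comment> \<open>The bound from \<open>Y2\<close> is used at \<open>-y\<close> and then moved
      by \<open>y\<close>, which returns \<open>V1\<close> to its place and puts the cutoff around
      \<open>y\<close>.\<close>
    have "form_bound (\<lambda>x. V1 (x - y - (- y)) * (sin (\<theta> (x - y)))\<^sup>2) e"
      by (rule form_bound_shift[OF Y2[rule_format]]) (use y in simp)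
    then have a4: "(\<integral>x. V1 x * (f2 x)\<^sup>2 \<partial>lborel) \<le> e * Dirichlet g"
      using form_bound_integral[OF _ g] by (fastforce simp: f2_def \<theta>'_def power_mult_distrib mult.assoc)
    let ?j = "\<lambda>x. (cos (\<theta> x))\<^sup>2 * (cos (\<theta>' x))\<^sup>2"
    have j3: "0 \<le> (cos a)\<^sup>2 * (cos b)\<^sup>2 \<and> (cos a)\<^sup>2 * (cos b)\<^sup>2 \<le> 1" for a b :: real
      using mult_mono[of "(cos a)\<^sup>2" 1 "(cos b)\<^sup>2" 1] j01(2)[of a] j01(2)[of b] by auto
    have j4: "(cos a)\<^sup>2 * (cos b)\<^sup>2 \<le> (cos a)\<^sup>2" "(cos b)\<^sup>2 * (cos a)\<^sup>2 \<le> (cos a)\<^sup>2" for a b :: real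
      using mult_left_mono[of "(cos b)\<^sup>2" 1 "(cos a)\<^sup>2"] j01(2)[of b] by (auto simp: mult.commute)
    have f3sq: "(f3 x)\<^sup>2 = ?j x * (f x)\<^sup>2" for x by (simp add: f3_def g_def power_mult_distrib mult_ac)
    have pole: "l * (\<integral>x. 1 / (norm (x - b))\<^sup>2 * (f3 x)\<^sup>2 \<partial>lborel) \<le> max l 0 * H * Dirichlet f3" for l and b :: "real^'n"
    proof -
      have "0 \<le> (\<integral>x. 1 / (norm (x - b))\<^sup>2 * (f3 x)\<^sup>2 \<partial>lborel)" by (rule integral_nonneg_AE) auto
      moreover have "(\<integral>x. 1 / (norm (x - b))\<^sup>2 * (f3 x)\<^sup>2 \<partial>lborel) \<le> H * Dirichlet f3"
        using form_bound_integral[OF form_bound_Hardy[OF N, of b] f3] by (simp add: H_def)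
      ultimately have "l * (\<integral>x. 1 / (norm (x - b))\<^sup>2 * (f3 x)\<^sup>2 \<partial>lborel) \<le> max l 0 * (\<integral>x. 1 / (norm (x - b))\<^sup>2 * (f3 x)\<^sup>2 \<partial>lborel)"
        and "max l 0 * (\<integral>x. 1 / (norm (x - b))\<^sup>2 * (f3 x)\<^sup>2 \<partial>lborel) \<le> max l 0 * (H * Dirichlet f3)"
        by (auto intro!: mult_right_mono mult_left_mono)
      then show ?thesis by (simp add: mult.assoc)
    qed
    \<comment> \<open>The pole part is tested on \<open>f3\<close>, where Hardy keeps its sharp
      constant; in the remainder the weight \<open>?j\<close> stays with the potential, to be tested
      on \<open>f\<close>.\<close>
    have outer: "(\<integral>x. U x * (f3 x)\<^sup>2 \<partial>lborel) \<le> max l 0 * H * Dirichlet f3 + e * Dirichlet f"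
      if E: "form_bound (\<lambda>x. (U x - l / (norm (x - b))\<^sup>2) * ?j x) e" for U l and b :: "real^'n"
    proof -
      let ?E = "\<lambda>x. (U x - l / (norm (x - b))\<^sup>2) * ?j x" and ?h = "\<lambda>x. 1 / (norm (x - b))\<^sup>2 * (f3 x)\<^sup>2"
      have "(\<integral>x. U x * (f3 x)\<^sup>2 \<partial>lborel) = (\<integral>x. l * ?h x + ?E x * (f x)\<^sup>2 \<partial>lborel)"
        by (intro Bochner_Integration.integral_cong refl) (simp add: f3sq algebra_simps)
      also have "\<dots> = l * (\<integral>x. ?h x \<partial>lborel) + (\<integral>x. ?E x * (f x)\<^sup>2 \<partial>lborel)"
        by (subst Bochner_Integration.integral_add[OF integrable_mult_right[OF
            form_bound_integrable[OF form_bound_Hardy[OF N, of b] f3]] form_bound_integrable[OF E f]])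
          (subst integral_mult_right_zero, rule refl)
      also have "\<dots> \<le> max l 0 * H * Dirichlet f3 + e * Dirichlet f"
        by (rule add_mono[OF pole abs_le_D1[OF form_bound_integral[OF E f]]])
      finally show ?thesis .
    qed
    have a5: "(\<integral>x. V1 x * (f3 x)\<^sup>2 \<partial>lborel) \<le> p1 * H * Dirichlet f3 + e * Dirichlet f"
      unfolding p1_def
    proof (rule outer[of _ _ 0])
      have "?j x \<le> \<eta>1" if "norm x < M1" for x
      proof -
        have "(cos (\<theta> x))\<^sup>2 \<le> \<eta>1" using tc that by (simp add: M_def \<eta>_def)
        then show ?thesis using j4(1) order_trans by blast
      qed
      then have E: "\<forall>x. norm x < M1 \<longrightarrow> ?j x \<le> \<eta>1" by blast
      have J: "\<forall>x. 0 \<le> ?j x \<and> ?j x \<le> 1" using j3 by blast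
      have jm: "?j \<in> borel_measurable borel" by measurable
      from bspec[OF B1 jm, THEN mp, OF J, THEN mp, OF E]
      show "form_bound (\<lambda>x. (V1 x - l1 / (norm (x - 0))\<^sup>2) * ?j x) e" by (simp only: diff_zero)
    qed
    have a6: "(\<integral>x. V2 (x - y) * (f3 x)\<^sup>2 \<partial>lborel) \<le> p2 * H * Dirichlet f3 + e * Dirichlet f"
      unfolding p2_def
    proof (rule outer[of _ _ y])
      \<comment> \<open>\<open>?j\<close> moved so that \<open>V2\<close> is centred at the origin;
        now the second factor gives the smallness there.\<close>
      let ?k = "\<lambda>x. (cos (\<theta> (x + y)))\<^sup>2 * (cos (\<theta> x))\<^sup>2"
      have "?k x \<le> \<eta>2" if "norm x < M2" for x
      proof -
        have "(cos (\<theta> x))\<^sup>2 \<le> \<eta>2" using tc that by (simp add: M_def \<eta>_def)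
        then show ?thesis using j4(2) order_trans by blast
      qed
      then have E: "\<forall>x. norm x < M2 \<longrightarrow> ?k x \<le> \<eta>2" by blast
      have J: "\<forall>x. 0 \<le> ?k x \<and> ?k x \<le> 1" using j3 by blast
      have km: "?k \<in> borel_measurable borel" by measurable
      have "form_bound (\<lambda>x. (V2 x - l2 / (norm x)\<^sup>2) * ?k x) e"
        by (rule bspec[OF B2 km, THEN mp, OF J, THEN mp, OF E])
      from form_bound_shift[OF this, of y]
      show "form_bound (\<lambda>x. (V2 (x - y) - l2 / (norm (x - y))\<^sup>2) * ?j x) e" by (simp add: \<theta>'_def)
    qed
    have "(\<integral>x. V x * (f x)\<^sup>2 \<partial>lborel) =
      (\<integral>x. (V1 x * (f1 x)\<^sup>2 + V2 (x - y) * (f1 x)\<^sup>2) + (V1 x * (f2 x)\<^sup>2 + V2 (x - y) * (f2 x)\<^sup>2)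
        + (V1 x * (f3 x)\<^sup>2 + V2 (x - y) * (f3 x)\<^sup>2) \<partial>lborel)"
      by (intro Bochner_Integration.integral_cong refl) (simp add: V_def split algebra_simps)
    also have "\<dots> = ((\<integral>x. V1 x * (f1 x)\<^sup>2 \<partial>lborel) + (\<integral>x. V2 (x - y) * (f1 x)\<^sup>2 \<partial>lborel))
        + ((\<integral>x. V1 x * (f2 x)\<^sup>2 \<partial>lborel) + (\<integral>x. V2 (x - y) * (f2 x)\<^sup>2 \<partial>lborel))
        + ((\<integral>x. V1 x * (f3 x)\<^sup>2 \<partial>lborel) + (\<integral>x. V2 (x - y) * (f3 x)\<^sup>2 \<partial>lborel))"
      by (simp add: I1[OF f1] I1[OF f2] I1[OF f3] I2[OF f1] I2[OF f2] I2[OF f3])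
    also have "\<dots> \<le> (1 - \<delta>) * Dirichlet f1 + (1 - \<delta>) * Dirichlet f2 + (1 - \<delta>) * Dirichlet f3
        + e * Dirichlet g + 3 * e * Dirichlet f"
    proof -
      have "(1 - m1) * Dirichlet f1 \<le> (1 - \<delta>) * Dirichlet f1" "(1 - m2) * Dirichlet f2 \<le> (1 - \<delta>) * Dirichlet f2"
        "(H * (p1 + p2)) * Dirichlet f3 \<le> (1 - \<delta>) * Dirichlet f3"
        using \<delta> n by (auto intro!: mult_right_mono)
      moreover have "(H * (p1 + p2)) * Dirichlet f3 = p1 * H * Dirichlet f3 + p2 * H * Dirichlet f3"
        by (simp add: algebra_simps)
      ultimately show ?thesis using a1 a2 a3 a4 a5 a6 by linarith
    qed
    also have "\<dots> \<le> (1 - \<delta> / 2) * Dirichlet f"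
    proof -
      \<comment> \<open>The two splittings cost \<open>3 * e\<close> in the sum of the three
        Dirichlet integrals, the term with \<open>g\<close> costs \<open>2 * e\<close>, and the
        direct errors cost \<open>3 * e\<close>.\<close>
      have g1: "Dirichlet g \<le> (1 + e) * Dirichlet f - Dirichlet f1" using D1 by simp
      have gf: "Dirichlet g \<le> 2 * Dirichlet f"
        using g1 n[of f1] mult_right_mono[of "1 + e" 2 "Dirichlet f"] e n[of f] by simp
      have "Dirichlet f1 + Dirichlet f2 + Dirichlet f3 \<le> Dirichlet f1 + Dirichlet g + e * Dirichlet g"
        using D2 by (simp add: distrib_right)
      also have "\<dots> \<le> (1 + e) * Dirichlet f + e * (2 * Dirichlet f)"
        using D1 gf e by (intro add_mono mult_left_mono) auto
      finally have "Dirichlet f1 + Dirichlet f2 + Dirichlet f3 \<le> (1 + 3 * e) * Dirichlet f" by (simp add: algebra_simps)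
      then have "(1 - \<delta>) * (Dirichlet f1 + Dirichlet f2 + Dirichlet f3) \<le> (1 - \<delta>) * ((1 + 3 * e) * Dirichlet f)"
        using \<delta> by (intro mult_left_mono) auto
      also have "\<dots> = ((1 - \<delta>) * (1 + 3 * e)) * Dirichlet f" by simp
      also have "\<dots> \<le> (1 - \<delta> + 3 * e) * Dirichlet f"
        using \<delta> e n[of f] by (intro mult_right_mono) (auto simp: algebra_simps)
      finally have "(1 - \<delta>) * Dirichlet f1 + (1 - \<delta>) * Dirichlet f2 + (1 - \<delta>) * Dirichlet f3 \<le> (1 - \<delta> + 3 * e) * Dirichlet f"
        by (simp add: distrib_left)
      moreover have "e * Dirichlet g \<le> e * (2 * Dirichlet f)" using gf e by (intro mult_left_mono) auto
      ultimately have "(1 - \<delta>) * Dirichlet f1 + (1 - \<delta>) * Dirichlet f2 + (1 - \<delta>) * Dirichlet f3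
        + e * Dirichlet g + 3 * e * Dirichlet f \<le> (1 - \<delta> + 8 * e) * Dirichlet f"
        by (simp add: algebra_simps)
      also have "1 - \<delta> + 8 * e = 1 - \<delta> / 2" by (simp add: e_def)
      finally show ?thesis .
    qed
    finally show "(\<integral>x. (V1 x + V2 (x - y)) * (f x)\<^sup>2 \<partial>lborel) \<le> (1 - \<delta> / 2) * Dirichlet f"
      by (simp add: V_def)
  qed
qed

theorem theorem1p5:
  fixes a1 a2 :: "nat \<Rightarrow> real^'n"
    and k1 k2 :: nat
    and r1 r2 lam1 lam2 :: "nat \<Rightarrow> real"
    and laminf1 laminf2 R1 R2 :: real
    and W1 W2 :: "real^'n \<Rightarrow> real"
  defines "V1 \<equiv> Vpot k1 a1 r1 lam1 laminf1 R1 W1"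
    and "V2 \<equiv> Vpot k2 a2 r2 lam2 laminf2 R2 W2"
  assumes "CARD('n) \<ge> 3"
    and "class_V_params k1 a1 r1 lam1 laminf1 R1 W1"
    and "class_V_params k2 a2 r2 lam2 laminf2 R2 W2"
    and "mu V1 > 0" and "mu V2 > 0"
    and "laminf1 + laminf2 < ((real CARD('n) - 2) / 2)\<^sup>2"
  shows "\<exists>R>0. \<forall>y::real^'n. norm y \<ge> R \<longrightarrow>
           (\<exists>\<epsilon>>0. \<forall>u G. in_D12 u G \<longrightarrow>
              integral\<^sup>L lborel (\<lambda>x. (norm (G x))\<^sup>2)
                - integral\<^sup>L lborel (\<lambda>x. (V1 x + V2 (x - y)) * (u x)\<^sup>2)
              \<ge> \<epsilon> * integral\<^sup>L lborel (\<lambda>x. (norm (G x))\<^sup>2))"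
proof -
  have V: "asymp_inverse_square V1 laminf1" "asymp_inverse_square V2 laminf2"
    unfolding V1_def V2_def using assms by (auto intro: class_V_asymp_inverse_square)
  obtain C1 C2 where C: "form_bound V1 C1" "form_bound V2 C2"
    using V by (auto simp: asymp_inverse_square_def)
  have l: "laminf1 < ((real CARD('n) - 2) / 2)\<^sup>2" "laminf2 < ((real CARD('n) - 2) / 2)\<^sup>2"
    using assms by (auto simp: class_V_params_def power_divide)
  obtain Y \<epsilon> where \<epsilon>: "0 < \<epsilon>" "\<epsilon> \<le> 1"
    and le: "\<forall>y. \<forall>f\<in>Cc_inf. norm y \<ge> Y \<longrightarrow>
      (\<integral>x. (V1 x + V2 (x - y)) * (f x)\<^sup>2 \<partial>lborel) \<le> (1 - \<epsilon>) * Dirichlet f"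
    by (rule two_potentials_form_le[OF \<open>CARD('n) \<ge> 3\<close> V \<open>mu V1 > 0\<close> \<open>mu V2 > 0\<close> l
        \<open>laminf1 + laminf2 < ((real CARD('n) - 2) / 2)\<^sup>2\<close>]) (rule that)
  have "\<epsilon> * (\<integral>x. (norm (G x))\<^sup>2 \<partial>lborel)
      \<le> (\<integral>x. (norm (G x))\<^sup>2 \<partial>lborel) - (\<integral>x. (V1 x + V2 (x - y)) * (u x)\<^sup>2 \<partial>lborel)"
    if y: "norm y \<ge> max Y 1" and u: "in_D12 u G" for y u G
  proof -
    have "(\<integral>x. (V1 x + V2 (x - y)) * (u x)\<^sup>2 \<partial>lborel) \<le> (1 - \<epsilon>) * (\<integral>x. (norm (G x))\<^sup>2 \<partial>lborel)"
      by (rule form_le_D12[OF form_bound_add[OF C(1) form_bound_shift[OF C(2)]] _ _ u]) (use \<epsilon> le y in auto)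
    then show ?thesis by (simp add: left_diff_distrib)
  qed
  \<comment> \<open>The maximum with 1 makes the radius positive whatever the sign of
    \<open>Y\<close>.\<close>
  then show ?thesis using \<epsilon> by (intro exI[of _ "max Y 1"]) auto
qed

end
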